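(* The functor $\exp:\mathbf{Nil}(\mathbb Z[\frac12])\to\mathbf{Nil}^{\frac12}$ extends to an isomorphism of categories between $\mathbf{Niq}(\mathbb Z[\frac12])$ and $\mathbf{Niq}^{\frac12}$.
   Context: A nil$_2$-group is a group $G$ with all triple commutators trivial, $[[G,G],G]=0$. For a map $f:G\to H$ of (additively written) groups put $(a\mid b)_f:=-(f(a)+f(b))+f(a+b)$. The map $f$ is weakly quadratic if for all $a,b,c\in G$ the element $(a\mid b)_f$ commutes with $f(c)$ and is additive in $a$ and in $b$; it is quadratic if moreover $(a\mid b)_f$ is central in $H$. A q-map of groups is a weakly quadratic map $f:G\to H$ between nil$_2$-groups with $(a\mid b)_f\in[H,H]$ for all $a,b$. $\mathbf{Niq}$ is the category of nil$_2$-groups and q-maps, $\mathbf{Niq}^{\frac12}$ its full subcategory on the uniquely 2-divisible nil$_2$-groups (those in which doubling $x\mapsto 2x$ is bijective), and $\mathbf{Nil}^{\frac12}$ the category of uniquely 2-divisible nil$_2$-groups and homomorphisms. All Lie algebras are Lie $\mathbb Z[\frac12]$-algebras $L$ with $[L,[L,L]]=0$; $\mathbf{Nil}(\mathbb Z[\frac12])$ is the category of these and Lie algebra homomorphisms. A map $f:L\to L'$ between such Lie algebras is a q-map if it is a quadratic map between the underlying abelian groups and for all $a,b\in L$ and $c\in[L,L]$ one has $(a\mid b)_f\in[L',L']$, $f(a+c)=f(a)+f(c)$ and $f(c)\in[L',L']$. $\mathbf{Niq}(\mathbb Z[\frac12])\supset\mathbf{Nil}(\mathbb Z[\frac12])$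 is the category with the same objects and with morphisms the q-maps of Lie algebras. The functor $\exp$ is the isomorphism of categories sending $L$ to the group with underlying set $L$ and operation $a\oplus b=a+b+\frac12[a,b]$, and each homomorphism to itself as a map of sets. *)

theory Defs
  imports Complex_Main "HOL-Algebra.Module" "HOL-Algebra.Generated_Groups"
begin

section \<open>Categories, functors, isomorphisms of categories\<close>

text \<open>
  Categories are presented by hom-sets, which need not be disjoint; the operation
  \<open>cat_comp C X Y Z g f\<close> is the composite \<open>g \<circ> f\<close> of \<open>f : X \<rightarrow> Y\<close> and \<open>g : Y \<rightarrow> Z\<close>.
\<close>

record ('o, 'm) cat =
  Obj :: "'o set"
  Arr :: "'o \<Rightarrow> 'o \<Rightarrow> 'm set"
  cat_id :: "'o \<Rightarrow> 'm"
  cat_comp :: "'o \<Rightarrow> 'o \<Rightarrow> 'o \<Rightarrow> 'm \<Rightarrow> 'm \<Rightarrow> 'm"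

definition is_category :: "('o, 'm) cat \<Rightarrow> bool" where
  "is_category C \<longleftrightarrow>
     (\<forall>X \<in> Obj C. cat_id C X \<in> Arr C X X) \<and>
     (\<forall>X \<in> Obj C. \<forall>Y \<in> Obj C. \<forall>Z \<in> Obj C. \<forall>f \<in> Arr C X Y. \<forall>g \<in> Arr C Y Z.
        cat_comp C X Y Z g f \<in> Arr C X Z) \<and>
     (\<forall>X \<in> Obj C. \<forall>Y \<in> Obj C. \<forall>f \<in> Arr C X Y.
        cat_comp C X X Y f (cat_id C X) = f \<and> cat_comp C X Y Y (cat_id C Y) f = f) \<and>
     (\<forall>W \<in> Obj C. \<forall>X \<in> Obj C. \<forall>Y \<in> Obj C. \<forall>Z \<in> Obj C.
        \<forall>f \<in> Arr C W X. \<forall>g \<in> Arr C X Y. \<forall>h \<in> Arr C Y Z.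
        cat_comp C W X Z (cat_comp C X Y Z h g) f = cat_comp C W Y Z h (cat_comp C W X Y g f))"

definition is_subcategory :: "('o, 'm) cat \<Rightarrow> ('o, 'm) cat \<Rightarrow> bool" where
  "is_subcategory C' C \<longleftrightarrow>
     is_category C' \<and> is_category C \<and> Obj C' \<subseteq> Obj C \<and>
     (\<forall>X \<in> Obj C'. \<forall>Y \<in> Obj C'. Arr C' X Y \<subseteq> Arr C X Y) \<and>
     (\<forall>X \<in> Obj C'. cat_id C' X = cat_id C X) \<and>
     (\<forall>X \<in> Obj C'. \<forall>Y \<in> Obj C'. \<forall>Z \<in> Obj C'. \<forall>f \<in> Arr C' X Y. \<forall>g \<in> Arr C' Y Z.
        cat_comp C' X Y Z g f = cat_comp C X Y Z g f)"

definition full_subcat :: "('o, 'm) cat \<Rightarrow> ('o \<Rightarrow> bool) \<Rightarrow> ('o, 'm) cat" where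
  "full_subcat C P = C \<lparr> Obj := {X \<in> Obj C. P X} \<rparr>"

record ('o, 'm, 'p, 'n) cat_map =
  on_obj :: "'o \<Rightarrow> 'p"
  on_arr :: "'o \<Rightarrow> 'o \<Rightarrow> 'm \<Rightarrow> 'n"

definition is_functor :: "('o, 'm) cat \<Rightarrow> ('p, 'n) cat \<Rightarrow> ('o, 'm, 'p, 'n) cat_map \<Rightarrow> bool" where
  "is_functor C D F \<longleftrightarrow>
     is_category C \<and> is_category D \<and>
     (\<forall>X \<in> Obj C. on_obj F X \<in> Obj D) \<and>
     (\<forall>X \<in> Obj C. \<forall>Y \<in> Obj C. \<forall>f \<in> Arr C X Y.
        on_arr F X Y f \<in> Arr D (on_obj F X) (on_obj F Y)) \<and>
     (\<forall>X \<in> Obj C. on_arr F X X (cat_id C X) = cat_id D (on_obj F X)) \<and>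
     (\<forall>X \<in> Obj C. \<forall>Y \<in> Obj C. \<forall>Z \<in> Obj C. \<forall>f \<in> Arr C X Y. \<forall>g \<in> Arr C Y Z.
        on_arr F X Z (cat_comp C X Y Z g f) =
        cat_comp D (on_obj F X) (on_obj F Y) (on_obj F Z) (on_arr F Y Z g) (on_arr F X Y f))"

definition left_inverse_functor ::
  "('o, 'm) cat \<Rightarrow> ('o, 'm, 'p, 'n) cat_map \<Rightarrow> ('p, 'n, 'o, 'm) cat_map \<Rightarrow> bool" where
  "left_inverse_functor C F G \<longleftrightarrow>
     (\<forall>X \<in> Obj C. on_obj G (on_obj F X) = X) \<and>
     (\<forall>X \<in> Obj C. \<forall>Y \<in> Obj C. \<forall>f \<in> Arr C X Y.
        on_arr G (on_obj F X) (on_obj F Y) (on_arr F X Y f) = f)"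

definition is_cat_isomorphism ::
  "('o, 'm) cat \<Rightarrow> ('p, 'n) cat \<Rightarrow> ('o, 'm, 'p, 'n) cat_map \<Rightarrow> bool" where
  "is_cat_isomorphism C D F \<longleftrightarrow>
     is_functor C D F \<and>
     (\<exists>G. is_functor D C G \<and> left_inverse_functor C F G \<and> left_inverse_functor D G F)"

text \<open>
  \<open>F : C \<rightarrow> D\<close> extends \<open>E : C' \<rightarrow> D'\<close>, where \<open>C'\<close> and \<open>D'\<close> are subcategories of \<open>C\<close> and \<open>D\<close>.
\<close>

definition extends_functor ::
  "('o, 'm) cat \<Rightarrow> ('p, 'n) cat \<Rightarrow> ('o, 'm, 'p, 'n) cat_map \<Rightarrow>
   ('o, 'm) cat \<Rightarrow> ('p, 'n) cat \<Rightarrow> ('o, 'm, 'p, 'n) cat_map \<Rightarrow> bool" where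
  "extends_functor C D F C' D' E \<longleftrightarrow>
     is_subcategory C' C \<and> is_subcategory D' D \<and>
     is_functor C D F \<and> is_functor C' D' E \<and>
     (\<forall>X \<in> Obj C'. on_obj F X = on_obj E X) \<and>
     (\<forall>X \<in> Obj C'. \<forall>Y \<in> Obj C'. \<forall>f \<in> Arr C' X Y. on_arr F X Y f = on_arr E X Y f)"

text \<open>
  A category of structures on subsets of a type \<open>'a\<close>, which plays the role of the universe.
  Arrows are extensional functions, so that two arrows with the same source are equal iff they
  agree on its carrier.
\<close>

definition structure_cat ::
  "('s \<Rightarrow> 'a set) \<Rightarrow> ('s \<Rightarrow> bool) \<Rightarrow> ('s \<Rightarrow> 's \<Rightarrow> ('a \<Rightarrow> 'a) \<Rightarrow> bool) \<Rightarrow> ('s, 'a \<Rightarrow> 'a) cat" where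
  "structure_cat car P mor =
     \<lparr> Obj = {X. P X},
       Arr = (\<lambda>X Y. {f \<in> car X \<rightarrow>\<^sub>E car Y. mor X Y f}),
       cat_id = (\<lambda>X. \<lambda>x \<in> car X. x),
       cat_comp = (\<lambda>X Y Z g f. compose (car X) g f) \<rparr>"


section \<open>Quadratic maps and nil-2-groups\<close>

text \<open>Groups are written multiplicatively, following the library.\<close>

definition cross_effect ::
  "('a, 'm) monoid_scheme \<Rightarrow> ('b, 'n) monoid_scheme \<Rightarrow> ('a \<Rightarrow> 'b) \<Rightarrow> 'a \<Rightarrow> 'a \<Rightarrow> 'b" where
  "cross_effect G H f a b = inv\<^bsub>H\<^esub> (f a \<otimes>\<^bsub>H\<^esub> f b) \<otimes>\<^bsub>H\<^esub> f (a \<otimes>\<^bsub>G\<^esub> b)"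

definition weakly_quadratic ::
  "('a, 'm) monoid_scheme \<Rightarrow> ('b, 'n) monoid_scheme \<Rightarrow> ('a \<Rightarrow> 'b) \<Rightarrow> bool" where
  "weakly_quadratic G H f \<longleftrightarrow>
     f \<in> carrier G \<rightarrow> carrier H \<and>
     (\<forall>a \<in> carrier G. \<forall>b \<in> carrier G. \<forall>c \<in> carrier G.
        cross_effect G H f a b \<otimes>\<^bsub>H\<^esub> f c = f c \<otimes>\<^bsub>H\<^esub> cross_effect G H f a b) \<and>
     (\<forall>a \<in> carrier G. \<forall>a' \<in> carrier G. \<forall>b \<in> carrier G.
        cross_effect G H f (a \<otimes>\<^bsub>G\<^esub> a') b = cross_effect G H f a b \<otimes>\<^bsub>H\<^esub> cross_effect G H f a' b) \<and>
     (\<forall>a \<in> carrier G. \<forall>b \<in> carrier G. \<forall>b' \<in> carrier G.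
        cross_effect G H f a (b \<otimes>\<^bsub>G\<^esub> b') = cross_effect G H f a b \<otimes>\<^bsub>H\<^esub> cross_effect G H f a b')"

definition quadratic ::
  "('a, 'm) monoid_scheme \<Rightarrow> ('b, 'n) monoid_scheme \<Rightarrow> ('a \<Rightarrow> 'b) \<Rightarrow> bool" where
  "quadratic G H f \<longleftrightarrow>
     weakly_quadratic G H f \<and>
     (\<forall>a \<in> carrier G. \<forall>b \<in> carrier G. \<forall>h \<in> carrier H.
        cross_effect G H f a b \<otimes>\<^bsub>H\<^esub> h = h \<otimes>\<^bsub>H\<^esub> cross_effect G H f a b)"

definition commutator :: "('a, 'm) monoid_scheme \<Rightarrow> 'a \<Rightarrow> 'a \<Rightarrow> 'a" where
  "commutator G x y = x \<otimes>\<^bsub>G\<^esub> y \<otimes>\<^bsub>G\<^esub> inv\<^bsub>G\<^esub> x \<otimes>\<^bsub>G\<^esub> inv\<^bsub>G\<^esub> y"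

definition nil2_group :: "('a, 'm) monoid_scheme \<Rightarrow> bool" where
  "nil2_group G \<longleftrightarrow>
     group G \<and>
     (\<forall>x \<in> derived G (carrier G). \<forall>y \<in> carrier G. commutator G x y = \<one>\<^bsub>G\<^esub>)"

definition uniquely_2_divisible :: "('a, 'm) monoid_scheme \<Rightarrow> bool" where
  "uniquely_2_divisible G \<longleftrightarrow> bij_betw (\<lambda>x. x \<otimes>\<^bsub>G\<^esub> x) (carrier G) (carrier G)"

definition group_qmap ::
  "('a, 'm) monoid_scheme \<Rightarrow> ('b, 'n) monoid_scheme \<Rightarrow> ('a \<Rightarrow> 'b) \<Rightarrow> bool" where
  "group_qmap G H f \<longleftrightarrow>
     nil2_group G \<and> nil2_group H \<and> weakly_quadratic G H f \<and>
     (\<forall>a \<in> carrier G. \<forall>b \<in> carrier G. cross_effect G H f a b \<in> derived H (carrier H))"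

text \<open>
  The multiplication of a group record is a total function on \<open>'a\<close>. Its irrelevant values off the
  carrier are fixed, so that equality of records is equality of groups, as needed for functors
  to be injective on objects in the usual sense.
\<close>

definition extensional_monoid :: "'a monoid \<Rightarrow> bool" where
  "extensional_monoid G \<longleftrightarrow> mult G = (\<lambda>x \<in> carrier G. \<lambda>y \<in> carrier G. x \<otimes>\<^bsub>G\<^esub> y)"

definition Niq :: "('a monoid, 'a \<Rightarrow> 'a) cat" where
  "Niq = structure_cat carrier (\<lambda>G. nil2_group G \<and> extensional_monoid G) group_qmap"

definition Niq_half :: "('a monoid, 'a \<Rightarrow> 'a) cat" where
  "Niq_half = full_subcat Niq uniquely_2_divisible"

definition Nil_half :: "('a monoid, 'a \<Rightarrow> 'a) cat" where
  "Nil_half = structure_cat carrier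
     (\<lambda>G. nil2_group G \<and> uniquely_2_divisible G \<and> extensional_monoid G)
     (\<lambda>G H f. f \<in> hom G H)"


section \<open>Lie algebras\<close>

text \<open>
  The record \<open>module\<close> inherits from \<open>ring\<close> the fields \<open>mult\<close> and \<open>one\<close>, which are not part of
  the structure of a module.
\<close>

record ('r, 'a) lie_alg = "('r, 'a) module" +
  bracket :: "'a \<Rightarrow> 'a \<Rightarrow> 'a"

locale lie_algebra = module R L
  for R :: "('r, 'm) ring_scheme" (structure) and L :: "('r, 'a) lie_alg" (structure) +
  assumes bracket_closed:
      "\<lbrakk>x \<in> carrier L; y \<in> carrier L\<rbrakk> \<Longrightarrow> bracket L x y \<in> carrier L"
    and bracket_add_left:
      "\<lbrakk>x \<in> carrier L; y \<in> carrier L; z \<in> carrier L\<rbrakk> \<Longrightarrow>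
       bracket L (x \<oplus>\<^bsub>L\<^esub> y) z = bracket L x z \<oplus>\<^bsub>L\<^esub> bracket L y z"
    and bracket_add_right:
      "\<lbrakk>x \<in> carrier L; y \<in> carrier L; z \<in> carrier L\<rbrakk> \<Longrightarrow>
       bracket L x (y \<oplus>\<^bsub>L\<^esub> z) = bracket L x y \<oplus>\<^bsub>L\<^esub> bracket L x z"
    and bracket_smult_left:
      "\<lbrakk>r \<in> carrier R; x \<in> carrier L; y \<in> carrier L\<rbrakk> \<Longrightarrow>
       bracket L (r \<odot>\<^bsub>L\<^esub> x) y = r \<odot>\<^bsub>L\<^esub> bracket L x y"
    and bracket_smult_right:
      "\<lbrakk>r \<in> carrier R; x \<in> carrier L; y \<in> carrier L\<rbrakk> \<Longrightarrow>
       bracket L x (r \<odot>\<^bsub>L\<^esub> y) = r \<odot>\<^bsub>L\<^esub> bracket L x y"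
    and bracket_self: "x \<in> carrier L \<Longrightarrow> bracket L x x = \<zero>\<^bsub>L\<^esub>"
    and jacobi:
      "\<lbrakk>x \<in> carrier L; y \<in> carrier L; z \<in> carrier L\<rbrakk> \<Longrightarrow>
       bracket L x (bracket L y z) \<oplus>\<^bsub>L\<^esub> bracket L y (bracket L z x) \<oplus>\<^bsub>L\<^esub>
       bracket L z (bracket L x y) = \<zero>\<^bsub>L\<^esub>"

text \<open>\<open>[L, L]\<close>: the submodule spanned by all brackets.\<close>

definition lie_derived :: "('r, 'm) ring_scheme \<Rightarrow> ('r, 'a) lie_alg \<Rightarrow> 'a set" where
  "lie_derived R L =
     \<Inter> {N. submodule N R L \<and> (\<forall>x \<in> carrier L. \<forall>y \<in> carrier L. bracket L x y \<in> N)}"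

definition Z_half :: "rat ring" where
  "Z_half = \<lparr> carrier = {of_int k / 2 ^ n | (k :: int) (n :: nat). True},
              mult = (*), one = 1, zero = 0, add = (+) \<rparr>"

definition nil2_lie :: "(rat, 'a) lie_alg \<Rightarrow> bool" where
  "nil2_lie L \<longleftrightarrow>
     lie_algebra Z_half L \<and>
     (\<forall>x \<in> carrier L. \<forall>c \<in> lie_derived Z_half L. bracket L x c = \<zero>\<^bsub>L\<^esub>)"

definition lie_hom :: "(rat, 'a) lie_alg \<Rightarrow> (rat, 'a) lie_alg \<Rightarrow> ('a \<Rightarrow> 'a) \<Rightarrow> bool" where
  "lie_hom L L' f \<longleftrightarrow>
     f \<in> carrier L \<rightarrow> carrier L' \<and>
     (\<forall>x \<in> carrier L. \<forall>y \<in> carrier L. f (x \<oplus>\<^bsub>L\<^esub> y) = f x \<oplus>\<^bsub>L'\<^esub> f y) \<and>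
     (\<forall>r \<in> carrier Z_half. \<forall>x \<in> carrier L. f (r \<odot>\<^bsub>L\<^esub> x) = r \<odot>\<^bsub>L'\<^esub> f x) \<and>
     (\<forall>x \<in> carrier L. \<forall>y \<in> carrier L. f (bracket L x y) = bracket L' (f x) (f y))"

definition lie_qmap :: "(rat, 'a) lie_alg \<Rightarrow> (rat, 'a) lie_alg \<Rightarrow> ('a \<Rightarrow> 'a) \<Rightarrow> bool" where
  "lie_qmap L L' f \<longleftrightarrow>
     quadratic (add_monoid L) (add_monoid L') f \<and>
     (\<forall>a \<in> carrier L. \<forall>b \<in> carrier L. \<forall>c \<in> lie_derived Z_half L.
        cross_effect (add_monoid L) (add_monoid L') f a b \<in> lie_derived Z_half L' \<and>
        f (a \<oplus>\<^bsub>L\<^esub> c) = f a \<oplus>\<^bsub>L'\<^esub> f c \<and>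
        f c \<in> lie_derived Z_half L')"

text \<open>As for groups, all values of record fields that carry no information are fixed.\<close>

definition extensional_lie :: "(rat, 'a) lie_alg \<Rightarrow> bool" where
  "extensional_lie L \<longleftrightarrow>
     mult L = undefined \<and> one L = undefined \<and>
     add L = (\<lambda>x \<in> carrier L. \<lambda>y \<in> carrier L. x \<oplus>\<^bsub>L\<^esub> y) \<and>
     smult L = (\<lambda>r \<in> carrier Z_half. \<lambda>x \<in> carrier L. r \<odot>\<^bsub>L\<^esub> x) \<and>
     bracket L = (\<lambda>x \<in> carrier L. \<lambda>y \<in> carrier L. bracket L x y)"

definition Nil_Lie :: "((rat, 'a) lie_alg, 'a \<Rightarrow> 'a) cat" where
  "Nil_Lie = structure_cat carrier (\<lambda>L. nil2_lie L \<and> extensional_lie L) lie_hom"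

definition Niq_Lie :: "((rat, 'a) lie_alg, 'a \<Rightarrow> 'a) cat" where
  "Niq_Lie = structure_cat carrier (\<lambda>L. nil2_lie L \<and> extensional_lie L) lie_qmap"


section \<open>The functor exp\<close>

definition exp_group :: "(rat, 'a) lie_alg \<Rightarrow> 'a monoid" where
  "exp_group L =
     \<lparr> carrier = carrier L,
       mult = (\<lambda>x \<in> carrier L. \<lambda>y \<in> carrier L.
                 x \<oplus>\<^bsub>L\<^esub> y \<oplus>\<^bsub>L\<^esub> (1 / 2) \<odot>\<^bsub>L\<^esub> bracket L x y),
       one = \<zero>\<^bsub>L\<^esub> \<rparr>"

definition exp_functor :: "((rat, 'a) lie_alg, 'a \<Rightarrow> 'a, 'a monoid, 'a \<Rightarrow> 'a) cat_map" where
  "exp_functor = \<lparr> on_obj = exp_group, on_arr = (\<lambda>L L' f. f) \<rparr>"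

end

theory Submission
  imports Defs
begin

text \<open>
  For a bimultiplicative map \<open>\<beta>\<close> with values in a central subgroup \<open>D\<close> on which it vanishes, the
  twisted operation \<open>x y \<beta>(x, y)\<close> is again a group law, and twisting by \<open>\<beta>\<inverse>\<close> undoes it. Both
  \<open>exp\<close> (with \<open>\<beta> = 1/2 [x, y]\<close>) and its inverse (with \<open>\<beta>\<close> the square root of the commutator
  \<open>[y, x]\<close>) are such twists. Call \<open>f : G \<rightarrow> H\<close> a q-map relative to \<open>D\<close> and \<open>E\<close> if its cross effect
  is bimultiplicative with values in \<open>E\<close>, and \<open>f\<close> maps \<open>D\<close> to \<open>E\<close> and is additive along \<open>D\<close>. With
  \<open>D\<close> and \<open>E\<close> the derived subobjects this describes the q-maps of Lie algebras as well as those of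
  groups, and the notion is invariant under twisting, because twisting \<open>G\<close> by
  \<open>\<beta>\<close> and \<open>H\<close> by \<open>\<gamma>\<close> changes the cross effect by the bimultiplicative factors \<open>f(\<beta>(a, b))\<close> and
  \<open>\<gamma>(f a, f b)\<inverse>\<close>. Hence \<open>exp\<close> does not change which maps are q-maps.
  On objects, the action of \<open>\<int>[1/2]\<close> is determined by the addition, so that \<open>exp\<close> is bijective.
\<close>

section \<open>Central twists\<close>

text \<open>\<open>D\<close> stays a parameter because it is instantiated in three ways: with the
  derived subgroup of a nil-2-group, with \<open>[L, L]\<close> inside \<open>add_monoid L\<close>,
  and with the center of a group.\<close>

locale central_subgroup = group G for G (structure) +
  fixes D
  assumes D_subgroup: "subgroup D G"
    and D_comm: "\<lbrakk>c \<in> D; x \<in> carrier G\<rbrakk> \<Longrightarrow> c \<otimes> x = x \<otimes> c"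
begin

lemma D_carrier [simp]: "c \<in> D \<Longrightarrow> c \<in> carrier G"
  using subgroup.mem_carrier[OF D_subgroup] .

lemma D_mult [simp]: "c \<in> D \<Longrightarrow> d \<in> D \<Longrightarrow> c \<otimes> d \<in> D"
  using subgroup.m_closed[OF D_subgroup] .

lemma D_inv [simp]: "c \<in> D \<Longrightarrow> inv c \<in> D"
  using subgroup.m_inv_closed[OF D_subgroup] .

lemma D_one [simp]: "\<one> \<in> D"
  using subgroup.one_closed[OF D_subgroup] .

lemma D_move: "\<lbrakk>c \<in> D; x \<in> carrier G; y \<in> carrier G\<rbrakk> \<Longrightarrow> x \<otimes> c \<otimes> y = x \<otimes> y \<otimes> c"
  by (metis D_carrier D_comm m_assoc)

lemma D_ac:
  "\<lbrakk>c \<in> D; d \<in> D\<rbrakk> \<Longrightarrow> c \<otimes> d = d \<otimes> c"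
  "\<lbrakk>c \<in> D; d \<in> D; e \<in> D\<rbrakk> \<Longrightarrow> c \<otimes> d \<otimes> e = c \<otimes> (d \<otimes> e)"
  "\<lbrakk>c \<in> D; d \<in> D; e \<in> D\<rbrakk> \<Longrightarrow> c \<otimes> (d \<otimes> e) = d \<otimes> (c \<otimes> e)"
  by (metis D_carrier D_comm m_assoc)+

lemma D_four:
  "\<lbrakk>c \<in> D; d \<in> D; c' \<in> D; d' \<in> D\<rbrakk> \<Longrightarrow> (c \<otimes> d) \<otimes> (c' \<otimes> d') = (c \<otimes> c') \<otimes> (d \<otimes> d')"
  by (simp add: D_ac)

lemma D_commutator: "\<lbrakk>c \<in> D; d \<in> D\<rbrakk> \<Longrightarrow> c \<otimes> d \<otimes> inv c \<otimes> inv d = \<one>"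
  by (simp add: D_move[of d c])

lemma inv_D_mult: "\<lbrakk>c \<in> D; d \<in> D\<rbrakk> \<Longrightarrow> inv (c \<otimes> d) = inv c \<otimes> inv d"
  by (metis D_ac(1) D_carrier inv_mult_group D_inv)

end

text \<open>Since \<beta> takes values in \<open>D\<close> and vanishes there, it does not see its
  own values as arguments. Hence \<beta> is bimultiplicative for the twisted product as well, and
  products with elements of \<open>D\<close> are not changed by the twist.\<close>

locale central_bimult = central_subgroup +
  fixes \<beta>
  assumes bm_closed [simp]: "\<lbrakk>x \<in> carrier G; y \<in> carrier G\<rbrakk> \<Longrightarrow> \<beta> x y \<in> D"
    and bm_left: "\<lbrakk>x \<in> carrier G; y \<in> carrier G; z \<in> carrier G\<rbrakk> \<Longrightarrow> \<beta> (x \<otimes> y) z = \<beta> x z \<otimes> \<beta> y z"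
    and bm_right: "\<lbrakk>x \<in> carrier G; y \<in> carrier G; z \<in> carrier G\<rbrakk> \<Longrightarrow> \<beta> x (y \<otimes> z) = \<beta> x y \<otimes> \<beta> x z"
    and bm_D_left [simp]: "\<lbrakk>c \<in> D; x \<in> carrier G\<rbrakk> \<Longrightarrow> \<beta> c x = \<one>"
    and bm_D_right [simp]: "\<lbrakk>c \<in> D; x \<in> carrier G\<rbrakk> \<Longrightarrow> \<beta> x c = \<one>"

text \<open>The product is cut off outside the carrier so that \<open>exp_group L\<close> is
  literally a twist of \<open>add_monoid L\<close>, see \<open>exp_group_twist\<close>.\<close>

definition twist :: "('a, 'm) monoid_scheme \<Rightarrow> ('a \<Rightarrow> 'a \<Rightarrow> 'a) \<Rightarrow> 'a monoid" where
  "twist G \<beta> = \<lparr> carrier = carrier G,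
     mult = (\<lambda>x \<in> carrier G. \<lambda>y \<in> carrier G. x \<otimes>\<^bsub>G\<^esub> y \<otimes>\<^bsub>G\<^esub> \<beta> x y),
     one = \<one>\<^bsub>G\<^esub> \<rparr>"

lemma twist_carrier [simp]: "carrier (twist G \<beta>) = carrier G"
  and twist_one [simp]: "\<one>\<^bsub>twist G \<beta>\<^esub> = \<one>\<^bsub>G\<^esub>"
  and twist_mult:
    "\<lbrakk>x \<in> carrier G; y \<in> carrier G\<rbrakk> \<Longrightarrow> x \<otimes>\<^bsub>twist G \<beta>\<^esub> y = x \<otimes>\<^bsub>G\<^esub> y \<otimes>\<^bsub>G\<^esub> \<beta> x y"
  by (simp_all add: twist_def)

context central_bimult
begin

lemma twist_mult_D:
  assumes "c \<in> D" "x \<in> carrier G"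
  shows "x \<otimes>\<^bsub>twist G \<beta>\<^esub> c = x \<otimes> c" "c \<otimes>\<^bsub>twist G \<beta>\<^esub> x = c \<otimes> x"
  using assms by (simp_all add: twist_mult)

lemma bm_left_twist:
  "\<lbrakk>x \<in> carrier G; y \<in> carrier G; z \<in> carrier G\<rbrakk> \<Longrightarrow> \<beta> (x \<otimes>\<^bsub>twist G \<beta>\<^esub> y) z = \<beta> x z \<otimes> \<beta> y z"
  by (simp add: twist_mult bm_left)

lemma bm_right_twist:
  "\<lbrakk>x \<in> carrier G; y \<in> carrier G; z \<in> carrier G\<rbrakk> \<Longrightarrow> \<beta> x (y \<otimes>\<^bsub>twist G \<beta>\<^esub> z) = \<beta> x y \<otimes> \<beta> x z"
  by (simp add: twist_mult bm_right)

lemma twist_closed: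
  "\<lbrakk>x \<in> carrier G; y \<in> carrier G\<rbrakk> \<Longrightarrow> x \<otimes>\<^bsub>twist G \<beta>\<^esub> y \<in> carrier G"
  by (simp add: twist_mult)

text \<open>A bimultiplicative map is a 2-cocycle: both bracketings give \<open>x y z\<close> times
  the same three central factors, one for each of the pairs \<open>(x, y)\<close>,
  \<open>(x, z)\<close> and \<open>(y, z)\<close>.\<close>

lemma twist_assoc:
  assumes [simp]: "x \<in> carrier G" "y \<in> carrier G" "z \<in> carrier G"
  shows "(x \<otimes>\<^bsub>twist G \<beta>\<^esub> y) \<otimes>\<^bsub>twist G \<beta>\<^esub> z = x \<otimes>\<^bsub>twist G \<beta>\<^esub> (y \<otimes>\<^bsub>twist G \<beta>\<^esub> z)"
proof -
  have "(x \<otimes>\<^bsub>twist G \<beta>\<^esub> y) \<otimes>\<^bsub>twist G \<beta>\<^esub> z = x \<otimes> y \<otimes> \<beta> x y \<otimes> z \<otimes> (\<beta> x z \<otimes> \<beta> y z)"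
    by (simp add: twist_mult bm_left)
  also have "\<dots> = x \<otimes> y \<otimes> z \<otimes> \<beta> x y \<otimes> (\<beta> x z \<otimes> \<beta> y z)"
    by (simp add: D_move)
  also have "\<dots> = x \<otimes> y \<otimes> z \<otimes> \<beta> y z \<otimes> (\<beta> x y \<otimes> \<beta> x z)"
    by (simp add: m_assoc D_ac)
  also have "\<dots> = x \<otimes>\<^bsub>twist G \<beta>\<^esub> (y \<otimes>\<^bsub>twist G \<beta>\<^esub> z)"
    by (simp add: twist_mult bm_right m_assoc)
  finally show ?thesis .
qed

lemma twist_group: "group (twist G \<beta>)"
proof (rule groupI)
  fix x assume "x \<in> carrier (twist G \<beta>)"
  then have x [simp]: "x \<in> carrier G" by simp
  \<comment> \<open>The left inverse is corrected by \<open>\<beta> x x\<close> because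
    \<open>\<beta> (inv x) x\<close> is its inverse; the correction lies in \<open>D\<close>, so it
    causes no further change.\<close>
  have "(inv x \<otimes> \<beta> x x) \<otimes>\<^bsub>twist G \<beta>\<^esub> x = inv x \<otimes> x \<otimes> \<beta> x x \<otimes> \<beta> (inv x) x"
    by (simp add: twist_mult D_move bm_left)
  also have "\<dots> = \<beta> (x \<otimes> inv x) x"
    by (simp only: bm_left x inv_closed) simp
  also have "\<dots> = \<one>" by simp
  finally have "(inv x \<otimes> \<beta> x x) \<otimes>\<^bsub>twist G \<beta>\<^esub> x = \<one>" .
  then show "\<exists>y \<in> carrier (twist G \<beta>). y \<otimes>\<^bsub>twist G \<beta>\<^esub> x = \<one>\<^bsub>twist G \<beta>\<^esub>"
    by (intro bexI[of _ "inv x \<otimes> \<beta> x x"]) simp_all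
qed (simp_all add: twist_closed twist_assoc, simp add: twist_mult)

lemma twist_inv_D:
  assumes "c \<in> D" shows "inv\<^bsub>twist G \<beta>\<^esub> c = inv c"
  by (rule group.inv_equality[OF twist_group]) (use assms in \<open>simp_all add: twist_mult_D\<close>)

lemma twist_central_subgroup: "central_subgroup (twist G \<beta>) D"
proof (intro central_subgroup.intro central_subgroup_axioms.intro twist_group)
  show "subgroup D (twist G \<beta>)"
    by (rule group.subgroupI[OF twist_group])
      (auto simp: twist_inv_D twist_mult_D intro: D_one)
qed (simp add: twist_mult_D, rule D_comm)

lemma inv_central_bimult: "central_bimult G D (\<lambda>x y. inv (\<beta> x y))"
  by unfold_locales (simp_all add: bm_left bm_right inv_D_mult)

lemma untwist_central_bimult: "central_bimult (twist G \<beta>) D (\<lambda>x y. inv (\<beta> x y))"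
proof -
  interpret T: central_subgroup "twist G \<beta>" D by (rule twist_central_subgroup)
  show ?thesis
    by unfold_locales (simp_all add: bm_left_twist bm_right_twist inv_D_mult twist_mult_D)
qed

text \<open>The second twist multiplies by an element of \<open>D\<close>, for which the twisted
  product is the original one, so the two factors cancel.\<close>

lemma untwist_mult:
  assumes [simp]: "x \<in> carrier G" "y \<in> carrier G"
  shows "x \<otimes>\<^bsub>twist (twist G \<beta>) (\<lambda>x y. inv (\<beta> x y))\<^esub> y = x \<otimes> y"
  by (simp add: twist_mult[of _ "twist G \<beta>"] twist_mult_D twist_closed)
    (simp add: twist_mult m_assoc)

end

text \<open>The cross effect appears as an unspecified \<open>q\<close> with
  \<open>f (a b) = f a f b q(a, b)\<close>. To verify the property it suffices to exhibit such a
  \<open>q\<close>, without computing with inverses; in groups cancellation makes it unique.\<close>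

definition qmap_rel ::
  "('a, 'm) monoid_scheme \<Rightarrow> 'a set \<Rightarrow> ('b, 'n) monoid_scheme \<Rightarrow> 'b set \<Rightarrow> ('a \<Rightarrow> 'b) \<Rightarrow> bool" where
  "qmap_rel G D H E f \<longleftrightarrow>
     f \<in> carrier G \<rightarrow> carrier H \<and> (\<forall>c \<in> D. f c \<in> E) \<and>
     (\<forall>a \<in> carrier G. \<forall>c \<in> D. f (a \<otimes>\<^bsub>G\<^esub> c) = f a \<otimes>\<^bsub>H\<^esub> f c) \<and>
     (\<exists>q. (\<forall>a \<in> carrier G. \<forall>b \<in> carrier G. q a b \<in> E \<and> f (a \<otimes>\<^bsub>G\<^esub> b) = f a \<otimes>\<^bsub>H\<^esub> f b \<otimes>\<^bsub>H\<^esub> q a b) \<and>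
          (\<forall>a \<in> carrier G. \<forall>a' \<in> carrier G. \<forall>b \<in> carrier G.
             q (a \<otimes>\<^bsub>G\<^esub> a') b = q a b \<otimes>\<^bsub>H\<^esub> q a' b \<and> q b (a \<otimes>\<^bsub>G\<^esub> a') = q b a \<otimes>\<^bsub>H\<^esub> q b a'))"

lemma qmap_relI:
  assumes "\<And>a. a \<in> carrier G \<Longrightarrow> f a \<in> carrier H"
    and "\<And>c. c \<in> D \<Longrightarrow> f c \<in> E"
    and "\<And>a c. a \<in> carrier G \<Longrightarrow> c \<in> D \<Longrightarrow> f (a \<otimes>\<^bsub>G\<^esub> c) = f a \<otimes>\<^bsub>H\<^esub> f c"
    and "\<And>a b. a \<in> carrier G \<Longrightarrow> b \<in> carrier G \<Longrightarrow> q a b \<in> E"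
    and "\<And>a b. a \<in> carrier G \<Longrightarrow> b \<in> carrier G \<Longrightarrow> f (a \<otimes>\<^bsub>G\<^esub> b) = f a \<otimes>\<^bsub>H\<^esub> f b \<otimes>\<^bsub>H\<^esub> q a b"
    and "\<And>a a' b. a \<in> carrier G \<Longrightarrow> a' \<in> carrier G \<Longrightarrow> b \<in> carrier G \<Longrightarrow>
           q (a \<otimes>\<^bsub>G\<^esub> a') b = q a b \<otimes>\<^bsub>H\<^esub> q a' b"
    and "\<And>a a' b. a \<in> carrier G \<Longrightarrow> a' \<in> carrier G \<Longrightarrow> b \<in> carrier G \<Longrightarrow>
           q b (a \<otimes>\<^bsub>G\<^esub> a') = q b a \<otimes>\<^bsub>H\<^esub> q b a'"
  shows "qmap_rel G D H E f"
  unfolding qmap_rel_def using assms by (intro conjI exI[of _ q]) auto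

lemma qmap_relE:
  assumes "qmap_rel G D H E f"
  obtains q where "\<And>a. a \<in> carrier G \<Longrightarrow> f a \<in> carrier H"
    and "\<And>c. c \<in> D \<Longrightarrow> f c \<in> E"
    and "\<And>a c. a \<in> carrier G \<Longrightarrow> c \<in> D \<Longrightarrow> f (a \<otimes>\<^bsub>G\<^esub> c) = f a \<otimes>\<^bsub>H\<^esub> f c"
    and "\<And>a b. a \<in> carrier G \<Longrightarrow> b \<in> carrier G \<Longrightarrow> q a b \<in> E"
    and "\<And>a b. a \<in> carrier G \<Longrightarrow> b \<in> carrier G \<Longrightarrow> f (a \<otimes>\<^bsub>G\<^esub> b) = f a \<otimes>\<^bsub>H\<^esub> f b \<otimes>\<^bsub>H\<^esub> q a b"
    and "\<And>a a' b. a \<in> carrier G \<Longrightarrow> a' \<in> carrier G \<Longrightarrow> b \<in> carrier G \<Longrightarrow>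
           q (a \<otimes>\<^bsub>G\<^esub> a') b = q a b \<otimes>\<^bsub>H\<^esub> q a' b"
    and "\<And>a a' b. a \<in> carrier G \<Longrightarrow> a' \<in> carrier G \<Longrightarrow> b \<in> carrier G \<Longrightarrow>
           q b (a \<otimes>\<^bsub>G\<^esub> a') = q b a \<otimes>\<^bsub>H\<^esub> q b a'"
proof -
  obtain q where q: "\<forall>a \<in> carrier G. \<forall>b \<in> carrier G. q a b \<in> E \<and> f (a \<otimes>\<^bsub>G\<^esub> b) = f a \<otimes>\<^bsub>H\<^esub> f b \<otimes>\<^bsub>H\<^esub> q a b"
    "\<forall>a \<in> carrier G. \<forall>a' \<in> carrier G. \<forall>b \<in> carrier G.
       q (a \<otimes>\<^bsub>G\<^esub> a') b = q a b \<otimes>\<^bsub>H\<^esub> q a' b \<and> q b (a \<otimes>\<^bsub>G\<^esub> a') = q b a \<otimes>\<^bsub>H\<^esub> q b a'"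
    using assms unfolding qmap_rel_def by blast
  have f: "f \<in> carrier G \<rightarrow> carrier H" "\<forall>c \<in> D. f c \<in> E"
     "\<forall>a \<in> carrier G. \<forall>c \<in> D. f (a \<otimes>\<^bsub>G\<^esub> c) = f a \<otimes>\<^bsub>H\<^esub> f c"
    using assms unfolding qmap_rel_def by blast+
  show thesis by (rule that[of q]) (use q f in blast)+
qed

text \<open>Twisting and untwisting returns a record that agrees with the original one only on the
  carrier. This lemma bridges the gap.\<close>

lemma qmap_rel_cong:
  assumes carrier: "carrier G = carrier G'" "carrier H = carrier H'"
    and mult: "\<And>x y. x \<in> carrier G \<Longrightarrow> y \<in> carrier G \<Longrightarrow> x \<otimes>\<^bsub>G\<^esub> y = x \<otimes>\<^bsub>G'\<^esub> y"
      "\<And>x y. x \<in> carrier H \<Longrightarrow> y \<in> carrier H \<Longrightarrow> x \<otimes>\<^bsub>H\<^esub> y = x \<otimes>\<^bsub>H'\<^esub> y"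
    and sub: "D \<subseteq> carrier G" "E \<subseteq> carrier H" and H: "monoid H"
    and f: "qmap_rel G D H E f"
  shows "qmap_rel G' D H' E f"
  using f
proof (rule qmap_relE)
  fix q assume q: "\<And>a. a \<in> carrier G \<Longrightarrow> f a \<in> carrier H"
    "\<And>c. c \<in> D \<Longrightarrow> f c \<in> E"
    "\<And>a c. a \<in> carrier G \<Longrightarrow> c \<in> D \<Longrightarrow> f (a \<otimes>\<^bsub>G\<^esub> c) = f a \<otimes>\<^bsub>H\<^esub> f c"
    "\<And>a b. a \<in> carrier G \<Longrightarrow> b \<in> carrier G \<Longrightarrow> q a b \<in> E"
    "\<And>a b. a \<in> carrier G \<Longrightarrow> b \<in> carrier G \<Longrightarrow> f (a \<otimes>\<^bsub>G\<^esub> b) = f a \<otimes>\<^bsub>H\<^esub> f b \<otimes>\<^bsub>H\<^esub> q a b"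
    "\<And>a a' b. a \<in> carrier G \<Longrightarrow> a' \<in> carrier G \<Longrightarrow> b \<in> carrier G \<Longrightarrow>
           q (a \<otimes>\<^bsub>G\<^esub> a') b = q a b \<otimes>\<^bsub>H\<^esub> q a' b"
    "\<And>a a' b. a \<in> carrier G \<Longrightarrow> a' \<in> carrier G \<Longrightarrow> b \<in> carrier G \<Longrightarrow>
           q b (a \<otimes>\<^bsub>G\<^esub> a') = q b a \<otimes>\<^bsub>H\<^esub> q b a'"
  have DE: "c \<in> D \<Longrightarrow> c \<in> carrier G" "e \<in> E \<Longrightarrow> e \<in> carrier H" for c e
    using sub by auto
  have mult': "\<And>x y. x \<in> carrier G \<Longrightarrow> y \<in> carrier G \<Longrightarrow> x \<otimes>\<^bsub>G'\<^esub> y = x \<otimes>\<^bsub>G\<^esub> y"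
      "\<And>x y. x \<in> carrier H \<Longrightarrow> y \<in> carrier H \<Longrightarrow> x \<otimes>\<^bsub>H'\<^esub> y = x \<otimes>\<^bsub>H\<^esub> y"
    using mult by simp_all
  show ?thesis
    by (rule qmap_relI[where q = q], unfold carrier[symmetric])
      (simp_all add: mult' DE q monoid.m_closed[OF H])
qed

section \<open>Calculus of relative q-maps: cross effects, composition, twisting\<close>

locale qmap = source: central_subgroup G D + target: central_subgroup H E
  for G (structure) and D and H (structure) and E +
  fixes f
  assumes qmap: "qmap_rel G D H E f"
begin

definition defect where
  "defect a b = inv\<^bsub>H\<^esub> (f a \<otimes>\<^bsub>H\<^esub> f b) \<otimes>\<^bsub>H\<^esub> f (a \<otimes>\<^bsub>G\<^esub> b)"

lemma f_closed [simp]: "a \<in> carrier G \<Longrightarrow> f a \<in> carrier H"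
  and f_D [simp]: "c \<in> D \<Longrightarrow> f c \<in> E"
  and f_mult_D: "\<lbrakk>a \<in> carrier G; c \<in> D\<rbrakk> \<Longrightarrow> f (a \<otimes>\<^bsub>G\<^esub> c) = f a \<otimes>\<^bsub>H\<^esub> f c"
  using qmap by (auto simp: qmap_rel_def)

lemma
  shows defect_closed [simp]: "\<lbrakk>a \<in> carrier G; b \<in> carrier G\<rbrakk> \<Longrightarrow> defect a b \<in> E"
    and f_mult: "\<lbrakk>a \<in> carrier G; b \<in> carrier G\<rbrakk> \<Longrightarrow> f (a \<otimes>\<^bsub>G\<^esub> b) = f a \<otimes>\<^bsub>H\<^esub> f b \<otimes>\<^bsub>H\<^esub> defect a b"
    and defect_left: "\<lbrakk>a \<in> carrier G; a' \<in> carrier G; b \<in> carrier G\<rbrakk> \<Longrightarrow>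
           defect (a \<otimes>\<^bsub>G\<^esub> a') b = defect a b \<otimes>\<^bsub>H\<^esub> defect a' b"
    and defect_right: "\<lbrakk>a \<in> carrier G; a' \<in> carrier G; b \<in> carrier G\<rbrakk> \<Longrightarrow>
           defect b (a \<otimes>\<^bsub>G\<^esub> a') = defect b a \<otimes>\<^bsub>H\<^esub> defect b a'"
proof -
  obtain q where q: "\<And>a b. a \<in> carrier G \<Longrightarrow> b \<in> carrier G \<Longrightarrow> q a b \<in> E"
    "\<And>a b. a \<in> carrier G \<Longrightarrow> b \<in> carrier G \<Longrightarrow> f (a \<otimes>\<^bsub>G\<^esub> b) = f a \<otimes>\<^bsub>H\<^esub> f b \<otimes>\<^bsub>H\<^esub> q a b"
    "\<And>a a' b. a \<in> carrier G \<Longrightarrow> a' \<in> carrier G \<Longrightarrow> b \<in> carrier G \<Longrightarrow>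
           q (a \<otimes>\<^bsub>G\<^esub> a') b = q a b \<otimes>\<^bsub>H\<^esub> q a' b"
    "\<And>a a' b. a \<in> carrier G \<Longrightarrow> a' \<in> carrier G \<Longrightarrow> b \<in> carrier G \<Longrightarrow>
           q b (a \<otimes>\<^bsub>G\<^esub> a') = q b a \<otimes>\<^bsub>H\<^esub> q b a'"
    using qmap by (rule qmap_relE) blast
  \<comment> \<open>Cancelling \<open>f a\<close> and \<open>f b\<close> identifies any witness
    \<open>q\<close> with the explicit cross effect, which therefore inherits its
    properties.\<close>
  have *: "defect a b = q a b" if "a \<in> carrier G" "b \<in> carrier G" for a b
    using that q(1)[OF that] unfolding defect_def q(2)[OF that]
    by (simp add: target.m_assoc[symmetric] target.inv_mult_group)
       (simp add: target.m_assoc target.inv_solve_left')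
  show "\<lbrakk>a \<in> carrier G; b \<in> carrier G\<rbrakk> \<Longrightarrow> defect a b \<in> E"
    "\<lbrakk>a \<in> carrier G; b \<in> carrier G\<rbrakk> \<Longrightarrow> f (a \<otimes>\<^bsub>G\<^esub> b) = f a \<otimes>\<^bsub>H\<^esub> f b \<otimes>\<^bsub>H\<^esub> defect a b"
    using q * by auto
  show "\<lbrakk>a \<in> carrier G; a' \<in> carrier G; b \<in> carrier G\<rbrakk> \<Longrightarrow>
           defect (a \<otimes>\<^bsub>G\<^esub> a') b = defect a b \<otimes>\<^bsub>H\<^esub> defect a' b"
    "\<lbrakk>a \<in> carrier G; a' \<in> carrier G; b \<in> carrier G\<rbrakk> \<Longrightarrow>
           defect b (a \<otimes>\<^bsub>G\<^esub> a') = defect b a \<otimes>\<^bsub>H\<^esub> defect b a'"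
    using q * by auto
qed

text \<open>Additivity along \<open>D\<close> says that the cross effect at \<open>(a, c)\<close> is
  trivial. As \<open>c\<close> and \<open>f c\<close> are central, exchanging the factors gives the
  other side.\<close>

lemma defect_D [simp]:
  assumes [simp]: "a \<in> carrier G" "c \<in> D"
  shows "defect a c = \<one>\<^bsub>H\<^esub>" "defect c a = \<one>\<^bsub>H\<^esub>"
proof -
  show "defect a c = \<one>\<^bsub>H\<^esub>"
    using f_mult_D[of a c] by (simp add: defect_def)
  show "defect c a = \<one>\<^bsub>H\<^esub>"
    using f_mult_D[of a c] by (simp add: defect_def source.D_comm target.D_comm)
qed

end

lemma qmap_comp:
  assumes "qmap G D H E f" "qmap H E K F g"
  shows "qmap_rel G D K F (\<lambda>x. g (f x))"
proof -
  interpret f: qmap G D H E f by fact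
  interpret g: qmap H E K F g by fact
  \<comment> \<open>The cross effect of \<open>f\<close> lies in \<open>E\<close>, where
    \<open>g\<close> is additive, so it passes through \<open>g\<close> as a separate factor.
    Bimultiplicativity holds because the cross effect of \<open>g\<close> vanishes on
    \<open>E\<close> and so treats \<open>f\<close> as multiplicative.\<close>
  let ?q = "\<lambda>a b. g.defect (f a) (f b) \<otimes>\<^bsub>K\<^esub> g (f.defect a b)"
  show ?thesis
  proof (rule qmap_relI[where q = ?q])
    fix a b assume [simp]: "a \<in> carrier G" "b \<in> carrier G"
    show "g (f (a \<otimes>\<^bsub>G\<^esub> b)) = g (f a) \<otimes>\<^bsub>K\<^esub> g (f b) \<otimes>\<^bsub>K\<^esub> ?q a b"
      by (simp add: f.f_mult g.f_mult_D g.f_mult g.target.m_assoc)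
  next
    fix a a' b assume [simp]: "a \<in> carrier G" "a' \<in> carrier G" "b \<in> carrier G"
    show "?q (a \<otimes>\<^bsub>G\<^esub> a') b = ?q a b \<otimes>\<^bsub>K\<^esub> ?q a' b" "?q b (a \<otimes>\<^bsub>G\<^esub> a') = ?q b a \<otimes>\<^bsub>K\<^esub> ?q b a'"
      by (simp_all add: f.f_mult f.defect_left f.defect_right g.defect_left g.defect_right
          g.f_mult_D g.target.D_ac)
  qed (simp_all add: f.f_mult_D g.f_mult_D)
qed

lemma qmap_twist:
  assumes "central_bimult G D \<beta>" "central_bimult H E \<gamma>" "qmap_rel G D H E f"
  shows "qmap_rel (twist G \<beta>) D (twist H \<gamma>) E f"
proof -
  interpret G: central_bimult G D \<beta> by fact
  interpret H: central_bimult H E \<gamma> by fact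
  interpret qmap G D H E f by unfold_locales fact
  interpret H': central_bimult H E "\<lambda>x y. inv\<^bsub>H\<^esub> (\<gamma> x y)" by (rule H.inv_central_bimult)
  \<comment> \<open>The twist of \<open>G\<close> contributes \<open>f (\<beta> a b)\<close>, split
    off by additivity along \<open>D\<close>; the inverse of \<gamma> compensates for the factor in
    the twisted product of \<open>f a\<close> and \<open>f b\<close>.\<close>
  let ?q = "\<lambda>a b. defect a b \<otimes>\<^bsub>H\<^esub> (f (\<beta> a b) \<otimes>\<^bsub>H\<^esub> inv\<^bsub>H\<^esub> (\<gamma> (f a) (f b)))"
  have f_twist: "f (a \<otimes>\<^bsub>twist G \<beta>\<^esub> b) = f a \<otimes>\<^bsub>H\<^esub> f b \<otimes>\<^bsub>H\<^esub> (defect a b \<otimes>\<^bsub>H\<^esub> f (\<beta> a b))"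
    if "a \<in> carrier G" "b \<in> carrier G" for a b
    using that by (simp add: twist_mult f_mult_D f_mult H.m_assoc)
  show ?thesis
  proof (rule qmap_relI[where q = ?q], goal_cases)
    case (3 a c)
    then show ?case by (simp add: G.twist_mult_D H.twist_mult_D f_mult_D)
  next
    case (5 a b)
    then have [simp]: "a \<in> carrier G" "b \<in> carrier G" by auto
    have "f a \<otimes>\<^bsub>twist H \<gamma>\<^esub> f b \<otimes>\<^bsub>twist H \<gamma>\<^esub> ?q a b = f a \<otimes>\<^bsub>H\<^esub> f b \<otimes>\<^bsub>H\<^esub> \<gamma> (f a) (f b) \<otimes>\<^bsub>H\<^esub> ?q a b"
      by (simp add: H.twist_mult_D H.twist_closed) (simp add: twist_mult)
    also have "\<dots> = f a \<otimes>\<^bsub>H\<^esub> f b \<otimes>\<^bsub>H\<^esub> (\<gamma> (f a) (f b) \<otimes>\<^bsub>H\<^esub> ?q a b)"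
      by (simp add: H.m_assoc)
    also have "\<gamma> (f a) (f b) \<otimes>\<^bsub>H\<^esub> ?q a b = defect a b \<otimes>\<^bsub>H\<^esub> f (\<beta> a b)"
      by (simp add: H.D_ac(3)[of "\<gamma> (f a) (f b)"])
    finally show ?case by (simp add: f_twist)
  next
    \<comment> \<open>By \<open>f_twist\<close>, \<open>f\<close> is multiplicative up to a factor
      in \<open>E\<close>. Since \<gamma> ignores that factor, \<gamma> composed with
      \<open>f\<close> is bimultiplicative.\<close>
    case (6 a a' b)
    then show ?case
      by (simp add: G.bm_left_twist f_twist H'.bm_left H.twist_mult_D f_mult_D)
        (simp add: twist_mult defect_left H.D_ac)
  next
    case (7 a a' b)
    then show ?case
      by (simp add: G.bm_right_twist f_twist H'.bm_right H.twist_mult_D f_mult_D)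
        (simp add: twist_mult defect_right H.D_ac)
  qed simp_all
qed

text \<open>The converse is \<open>qmap_twist\<close> again, applied to the inverse twists.\<close>

lemma qmap_twist_iff:
  assumes "central_bimult G D \<beta>" "central_bimult H E \<gamma>"
  shows "qmap_rel (twist G \<beta>) D (twist H \<gamma>) E f \<longleftrightarrow> qmap_rel G D H E f"
proof
  interpret G: central_bimult G D \<beta> by fact
  interpret H: central_bimult H E \<gamma> by fact
  assume "qmap_rel (twist G \<beta>) D (twist H \<gamma>) E f"
  from qmap_twist[OF G.untwist_central_bimult H.untwist_central_bimult this]
  show "qmap_rel G D H E f"
    by (rule qmap_rel_cong[rotated -1])
      (use central_bimult.twist_group[OF H.untwist_central_bimult] in
        \<open>auto simp: G.untwist_mult H.untwist_mult group_def\<close>)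
qed (rule qmap_twist[OF assms])

section \<open>The two notions of q-map\<close>

lemma nil2_central_subgroup:
  assumes "nil2_group G"
  shows "central_subgroup G (derived G (carrier G))"
proof -
  interpret group G using assms by (simp add: nil2_group_def)
  show ?thesis
  proof (intro central_subgroup.intro central_subgroup_axioms.intro group_axioms)
    show "subgroup (derived G (carrier G)) G"
      by (simp add: derived_is_subgroup)
    fix c x assume c: "c \<in> derived G (carrier G)" and x: "x \<in> carrier G"
    have cc: "c \<in> carrier G" using c derived_in_carrier by blast
    have "commutator G c x = \<one>\<^bsub>G\<^esub>" using assms c x by (simp add: nil2_group_def)
    then show "c \<otimes>\<^bsub>G\<^esub> x = x \<otimes>\<^bsub>G\<^esub> c"
      using cc x unfolding commutator_def
      by (metis inv_closed inv_solve_right' l_one m_closed one_closed)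
  qed
qed

section \<open>Commutators, and q-maps of groups as relative q-maps\<close>

lemma commutator_in_derived:
  "\<lbrakk>x \<in> carrier G; y \<in> carrier G\<rbrakk> \<Longrightarrow> commutator G x y \<in> derived G (carrier G)"
  unfolding derived_def commutator_def by (rule generate.incl) auto

lemma (in group) commutator_closed [simp]:
  "\<lbrakk>x \<in> carrier G; y \<in> carrier G\<rbrakk> \<Longrightarrow> commutator G x y \<in> carrier G"
  by (simp add: commutator_def)

lemma (in group) commutator_mult:
  "\<lbrakk>x \<in> carrier G; y \<in> carrier G\<rbrakk> \<Longrightarrow> commutator G x y \<otimes> (y \<otimes> x) = x \<otimes> y"
  unfolding commutator_def by (simp add: m_assoc inv_solve_left) (simp add: m_assoc[symmetric])

lemma (in group) commutator_eqI:
  "\<lbrakk>x \<in> carrier G; y \<in> carrier G; c \<in> carrier G; c \<otimes> (y \<otimes> x) = x \<otimes> y\<rbrakk> \<Longrightarrow> commutator G x y = c"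
  by (metis commutator_closed commutator_mult m_closed right_cancel)

lemma (in group) derived_subset:
  assumes "subgroup K G" "\<And>x y. \<lbrakk>x \<in> carrier G; y \<in> carrier G\<rbrakk> \<Longrightarrow> commutator G x y \<in> K"
  shows "derived G (carrier G) \<subseteq> K"
  unfolding derived_def
  by (rule generate_subgroup_incl) (use assms in \<open>auto simp: commutator_def\<close>)

text \<open>For groups, preservation of derived subgroups and additivity along them are
  consequences. The cross effect is bimultiplicative with values in an abelian group, so it kills
  commutators; this gives additivity along the derived subgroup. Comparing \<open>f (x y)\<close>
  with \<open>f ([x, y] y x)\<close> then shows that \<open>f\<close> maps commutators into the
  derived subgroup.\<close>

lemma group_qmap_imp_qmap_rel:
  assumes f: "group_qmap G H f"
  shows "qmap_rel G (derived G (carrier G)) H (derived H (carrier H)) f"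
proof -
  let ?D = "derived G (carrier G)" and ?E = "derived H (carrier H)"
  have nil: "nil2_group G" "nil2_group H" using f by (auto simp: group_qmap_def)
  interpret G: central_subgroup G ?D by (rule nil2_central_subgroup) fact
  interpret H: central_subgroup H ?E by (rule nil2_central_subgroup) fact
  define q where "q = cross_effect G H f"
  have q_closed [simp]: "q a b \<in> ?E" if "a \<in> carrier G" "b \<in> carrier G" for a b
    using f that by (simp add: group_qmap_def q_def)
  have q_left: "q (a \<otimes>\<^bsub>G\<^esub> a') b = q a b \<otimes>\<^bsub>H\<^esub> q a' b"
    and q_right: "q b (a \<otimes>\<^bsub>G\<^esub> a') = q b a \<otimes>\<^bsub>H\<^esub> q b a'"
    if "a \<in> carrier G" "a' \<in> carrier G" "b \<in> carrier G" for a a' b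
    using f that by (simp_all add: group_qmap_def weakly_quadratic_def q_def)
  have f_closed [simp]: "a \<in> carrier G \<Longrightarrow> f a \<in> carrier H" for a
    using f by (auto simp: group_qmap_def weakly_quadratic_def)
  have f_mult: "f (a \<otimes>\<^bsub>G\<^esub> b) = f a \<otimes>\<^bsub>H\<^esub> f b \<otimes>\<^bsub>H\<^esub> q a b"
    if "a \<in> carrier G" "b \<in> carrier G" for a b
    using that by (simp add: q_def cross_effect_def H.m_assoc[symmetric] H.inv_mult_group)
      (simp add: H.m_assoc)
  have q_one: "q \<one>\<^bsub>G\<^esub> a = \<one>\<^bsub>H\<^esub>" "q a \<one>\<^bsub>G\<^esub> = \<one>\<^bsub>H\<^esub>" if "a \<in> carrier G" for a
    using q_left[of "\<one>\<^bsub>G\<^esub>" "\<one>\<^bsub>G\<^esub>" a] q_right[of "\<one>\<^bsub>G\<^esub>" "\<one>\<^bsub>G\<^esub>" a] that by simp_all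
  \<comment> \<open>\<open>K\<close> is the two-sided radical of \<open>q\<close>: a subgroup, which
    will contain all commutators.\<close>
  define K where "K = {x \<in> carrier G. \<forall>a \<in> carrier G. q x a = \<one>\<^bsub>H\<^esub> \<and> q a x = \<one>\<^bsub>H\<^esub>}"
  have q_inv: "q (inv\<^bsub>G\<^esub> x) a = inv\<^bsub>H\<^esub> (q x a)" "q a (inv\<^bsub>G\<^esub> x) = inv\<^bsub>H\<^esub> (q a x)"
    if "a \<in> carrier G" "x \<in> carrier G" for a x
    using q_left[of "inv\<^bsub>G\<^esub> x" x a] q_right[of "inv\<^bsub>G\<^esub> x" x a] that
    by (simp_all add: q_one H.inv_equality)
  have "?D \<subseteq> K"
  proof (rule G.derived_subset)
    show "subgroup K G"
      by (rule G.subgroupI) (auto simp: K_def q_left q_right q_inv q_one)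
    fix x y assume [simp]: "x \<in> carrier G" "y \<in> carrier G"
    have "q (commutator G x y) a = \<one>\<^bsub>H\<^esub>" "q a (commutator G x y) = \<one>\<^bsub>H\<^esub>" if [simp]: "a \<in> carrier G" for a
      by (simp_all add: commutator_def q_left q_right q_inv H.D_commutator)
    then show "commutator G x y \<in> K" by (simp add: K_def)
  qed
  then have qD [simp]: "q c a = \<one>\<^bsub>H\<^esub>" "q a c = \<one>\<^bsub>H\<^esub>" if "c \<in> ?D" "a \<in> carrier G" for a c
    using that by (auto simp: K_def)
  have f_D: "f (c \<otimes>\<^bsub>G\<^esub> a) = f c \<otimes>\<^bsub>H\<^esub> f a" "f (a \<otimes>\<^bsub>G\<^esub> c) = f a \<otimes>\<^bsub>H\<^esub> f c"
    if "c \<in> ?D" "a \<in> carrier G" for a c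
    using that by (simp_all add: f_mult)
  have f_one: "f \<one>\<^bsub>G\<^esub> = \<one>\<^bsub>H\<^esub>"
    using f_D(1)[of "\<one>\<^bsub>G\<^esub>" "\<one>\<^bsub>G\<^esub>"] by simp
  \<comment> \<open>The condition \<open>f c \<in> ?E\<close> cuts out a subgroup only inside
    \<open>?D\<close>, where \<open>f\<close> is multiplicative, hence the intersection with
    \<open>?D\<close>.\<close>
  have "?D \<subseteq> {c \<in> ?D. f c \<in> ?E}"
  proof (rule G.derived_subset)
    have "f (inv\<^bsub>G\<^esub> c) = inv\<^bsub>H\<^esub> (f c)" if "c \<in> ?D" for c
      using f_D(1)[of "inv\<^bsub>G\<^esub> c" c] that by (simp add: f_one H.inv_equality)
    then show "subgroup {c \<in> ?D. f c \<in> ?E} G"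
      by (intro G.subgroupI) (auto simp: f_D f_one intro!: exI[of _ "\<one>\<^bsub>G\<^esub>"])
    fix x y assume [simp]: "x \<in> carrier G" "y \<in> carrier G"
    let ?c = "commutator G x y" and ?c' = "commutator H (f x) (f y)"
    have cD [simp]: "?c \<in> ?D" "?c' \<in> ?E" by (simp_all add: commutator_in_derived)
    \<comment> \<open>Computing \<open>f (x y)\<close> in two ways yields
      \<open>f [x, y] = [f x, f y] q(x, y) q(y, x)^-1\<close>, and every factor on the right lies in
      \<open>?E\<close>.\<close>
    have "f ?c \<otimes>\<^bsub>H\<^esub> q y x \<otimes>\<^bsub>H\<^esub> (f y \<otimes>\<^bsub>H\<^esub> f x) = f ?c \<otimes>\<^bsub>H\<^esub> f (y \<otimes>\<^bsub>G\<^esub> x)"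
      by (simp add: f_mult H.m_assoc H.D_comm[of "q y x" "f y \<otimes>\<^bsub>H\<^esub> f x"])
    also have "\<dots> = f (x \<otimes>\<^bsub>G\<^esub> y)"
      using f_D(1)[of ?c "y \<otimes>\<^bsub>G\<^esub> x"] by (simp add: G.commutator_mult)
    also have "\<dots> = ?c' \<otimes>\<^bsub>H\<^esub> (f y \<otimes>\<^bsub>H\<^esub> f x) \<otimes>\<^bsub>H\<^esub> q x y"
      by (simp add: f_mult H.commutator_mult)
    also have "\<dots> = ?c' \<otimes>\<^bsub>H\<^esub> q x y \<otimes>\<^bsub>H\<^esub> (f y \<otimes>\<^bsub>H\<^esub> f x)"
      using H.D_move[of "q x y" ?c' "f y \<otimes>\<^bsub>H\<^esub> f x"] by simp
    finally have "f ?c \<otimes>\<^bsub>H\<^esub> q y x = ?c' \<otimes>\<^bsub>H\<^esub> q x y"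
      by simp
    then have "f ?c = ?c' \<otimes>\<^bsub>H\<^esub> q x y \<otimes>\<^bsub>H\<^esub> inv\<^bsub>H\<^esub> (q y x)"
      by (simp add: H.inv_solve_right)
    then show "?c \<in> {c \<in> ?D. f c \<in> ?E}" by simp
  qed
  then have "f c \<in> ?E" if "c \<in> ?D" for c using that by blast
  then show ?thesis
    by (intro qmap_relI[where q = q]) (simp_all add: f_D f_mult q_left q_right)
qed

lemma qmap_cross_effect: "qmap G D H E f \<Longrightarrow> cross_effect G H f = qmap.defect G H f"
  by (intro ext) (simp add: cross_effect_def qmap.defect_def)

lemma qmap_quadratic:
  assumes "qmap G D H E f"
  shows "quadratic G H f"
proof -
  interpret qmap G D H E f by fact
  show ?thesis
    unfolding quadratic_def weakly_quadratic_def qmap_cross_effect[OF assms]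
    by (auto simp: defect_left defect_right intro!: target.D_comm)
qed

lemma group_qmap_iff:
  assumes "nil2_group G" "nil2_group H"
  shows "group_qmap G H f \<longleftrightarrow> qmap_rel G (derived G (carrier G)) H (derived H (carrier H)) f"
proof
  assume f: "qmap_rel G (derived G (carrier G)) H (derived H (carrier H)) f"
  have *: "qmap G (derived G (carrier G)) H (derived H (carrier H)) f"
    using assms f by (intro qmap.intro nil2_central_subgroup qmap_axioms.intro)
  show "group_qmap G H f"
    unfolding group_qmap_def qmap_cross_effect[OF *]
    using assms qmap_quadratic[OF *] qmap.defect_closed[OF *] by (simp add: quadratic_def)
qed (rule group_qmap_imp_qmap_rel)

section \<open>Derived submodules, and q-maps of Lie algebras as relative q-maps\<close>

lemma (in lie_algebra) lie_derived_submodule: "submodule (lie_derived R L) R L"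
proof -
  have *: "lie_derived R L \<subseteq> carrier L"
    unfolding lie_derived_def using carrier_is_submodule bracket_closed by blast
  show ?thesis
  proof (rule submoduleI)
    show "lie_derived R L \<subseteq> carrier L" by fact
    show "\<zero>\<^bsub>L\<^esub> \<in> lie_derived R L"
      using subgroup.one_closed[OF submodule.axioms(1)] by (fastforce simp: lie_derived_def)
  qed (use submoduleE(3-5) in \<open>auto simp: lie_derived_def\<close>)
qed

lemma (in lie_algebra) bracket_in_lie_derived:
  "\<lbrakk>x \<in> carrier L; y \<in> carrier L\<rbrakk> \<Longrightarrow> bracket L x y \<in> lie_derived R L"
  by (auto simp: lie_derived_def)

lemma (in lie_algebra) lie_derived_minimal:
  "\<lbrakk>submodule N R L; \<And>x y. \<lbrakk>x \<in> carrier L; y \<in> carrier L\<rbrakk> \<Longrightarrow> bracket L x y \<in> N\<rbrakk>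
    \<Longrightarrow> lie_derived R L \<subseteq> N"
  by (auto simp: lie_derived_def)

lemma (in lie_algebra) bracket_anticomm:
  assumes [simp]: "x \<in> carrier L" "y \<in> carrier L"
  shows "bracket L x y = \<ominus>\<^bsub>L\<^esub> bracket L y x"
proof -
  have "\<zero>\<^bsub>L\<^esub> = bracket L (x \<oplus>\<^bsub>L\<^esub> y) (x \<oplus>\<^bsub>L\<^esub> y)" by (simp add: bracket_self)
  also have "\<dots> = bracket L x x \<oplus>\<^bsub>L\<^esub> bracket L y x \<oplus>\<^bsub>L\<^esub> (bracket L x y \<oplus>\<^bsub>L\<^esub> bracket L y y)"
    by (simp only: bracket_add_left bracket_add_right bracket_closed assms add.m_closed)
  also have "\<dots> = bracket L x y \<oplus>\<^bsub>L\<^esub> bracket L y x"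
    by (simp add: bracket_self bracket_closed a_comm)
  finally show ?thesis
    by (metis assms bracket_closed minus_equality)
qed

lemma lie_central_subgroup:
  assumes "nil2_lie L"
  shows "central_subgroup (add_monoid L) (lie_derived Z_half L)"
proof -
  interpret lie_algebra Z_half L using assms by (simp add: nil2_lie_def)
  show ?thesis
    by (intro central_subgroup.intro central_subgroup_axioms.intro a_group
        submodule.axioms(1)[OF lie_derived_submodule])
      (use submoduleE(1)[OF lie_derived_submodule] in \<open>auto simp: a_comm\<close>)
qed

lemma lie_qmap_iff:
  assumes "nil2_lie L" "nil2_lie L'"
  shows "lie_qmap L L' f \<longleftrightarrow>
    qmap_rel (add_monoid L) (lie_derived Z_half L) (add_monoid L') (lie_derived Z_half L') f"
    (is "_ \<longleftrightarrow> qmap_rel ?G ?D ?H ?E f")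
proof
  interpret G: central_subgroup ?G ?D by (rule lie_central_subgroup) fact
  interpret H: central_subgroup ?H ?E by (rule lie_central_subgroup) fact
  have [simp]: "\<zero>\<^bsub>L\<^esub> \<in> carrier L" using G.one_closed by simp
  {
    assume f: "lie_qmap L L' f"
    then have fc: "f a \<in> carrier ?H" if "a \<in> carrier ?G" for a
      using that by (auto simp: lie_qmap_def quadratic_def weakly_quadratic_def)
    have f': "cross_effect ?G ?H f a b \<in> ?E \<and> f (a \<oplus>\<^bsub>L\<^esub> c) = f a \<oplus>\<^bsub>L'\<^esub> f c \<and> f c \<in> ?E"
      if "a \<in> carrier L" "b \<in> carrier L" "c \<in> ?D" for a b c
      using f that by (simp add: lie_qmap_def)
    show "qmap_rel ?G ?D ?H ?E f"
    proof (rule qmap_relI[where q = "cross_effect ?G ?H f"])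
      fix a b assume ab: "a \<in> carrier ?G" "b \<in> carrier ?G"
      note c = fc[OF ab(1)] fc[OF ab(2)] fc[OF G.m_closed[OF ab]]
      show "f (a \<otimes>\<^bsub>?G\<^esub> b) = f a \<otimes>\<^bsub>?H\<^esub> f b \<otimes>\<^bsub>?H\<^esub> cross_effect ?G ?H f a b"
        unfolding cross_effect_def using H.m_closed[OF c(1,2)] c(3)
        by (simp only: H.m_assoc[symmetric] H.inv_closed H.r_inv H.l_one)
    \<comment> \<open>The clauses of \<open>lie_qmap\<close> are quantified jointly over
      \<open>a\<close>, \<open>b\<close> and \<open>c\<close>; zero is inserted for the variables
      that a clause does not mention.\<close>
    qed (use f fc f'[OF _ _ G.D_one] f'[of "\<zero>\<^bsub>L\<^esub>" "\<zero>\<^bsub>L\<^esub>"] f' in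
        \<open>simp_all add: lie_qmap_def quadratic_def weakly_quadratic_def\<close>)
  }
  assume "qmap_rel ?G ?D ?H ?E f"
  then have *: "qmap ?G ?D ?H ?E f"
    by (intro qmap.intro G.central_subgroup_axioms H.central_subgroup_axioms qmap_axioms.intro)
  show "lie_qmap L L' f"
    unfolding lie_qmap_def qmap_cross_effect[OF *]
    using qmap_quadratic[OF *] qmap.defect_closed[OF *] qmap.f_mult_D[OF *] qmap.f_D[OF *] by simp
qed

section \<open>Dyadic multiples\<close>

lemma Z_half_carrier: "r \<in> carrier Z_half \<longleftrightarrow> (\<exists>k n. r * 2 ^ n = of_int k)"
  by (auto simp: Z_half_def field_simps)

lemma Z_half_simps [simp]:
  "\<one>\<^bsub>Z_half\<^esub> = 1" "\<zero>\<^bsub>Z_half\<^esub> = 0" "r \<oplus>\<^bsub>Z_half\<^esub> s = r + s" "r \<otimes>\<^bsub>Z_half\<^esub> s = r * s"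
  by (simp_all add: Z_half_def)

lemma Z_half_of_int [simp]: "of_int k \<in> carrier Z_half"
  unfolding Z_half_carrier by (rule exI[of _ k], rule exI[of _ 0]) simp

lemma Z_half_numerals [simp]:
  "0 \<in> carrier Z_half" "1 \<in> carrier Z_half" "2 \<in> carrier Z_half" "1/2 \<in> carrier Z_half"
  "2 ^ n \<in> carrier Z_half" "1 / 2 ^ n \<in> carrier Z_half"
  using Z_half_of_int[of 0] Z_half_of_int[of 1] Z_half_of_int[of 2] Z_half_of_int[of "2^n"]
  by (simp_all add: Z_half_carrier)
     (rule exI[of _ 1], rule exI[of _ 1], simp, rule exI[of _ 1], rule exI[of _ n], simp)

lemma Z_half_closed [simp]:
  assumes "r \<in> carrier Z_half" "s \<in> carrier Z_half"
  shows "r + s \<in> carrier Z_half" "r * s \<in> carrier Z_half"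
proof -
  obtain k n l m where rs: "r * 2 ^ n = of_int k" "s * 2 ^ m = of_int l"
    using assms by (auto simp: Z_half_carrier)
  have "(r + s) * 2 ^ (n + m) = of_int (k * 2 ^ m + l * 2 ^ n)"
    using rs[symmetric] by (simp add: power_add algebra_simps)
  moreover have "(r * s) * 2 ^ (n + m) = of_int (k * l)"
    using rs[symmetric] by (simp add: power_add algebra_simps)
  ultimately show "r + s \<in> carrier Z_half" "r * s \<in> carrier Z_half"
    unfolding Z_half_carrier by blast+
qed

lemma Z_half_uminus [simp]: "r \<in> carrier Z_half \<Longrightarrow> - r \<in> carrier Z_half"
  using Z_half_closed(2)[of "- 1" r] Z_half_of_int[of "- 1"] by simp

lemma Z_half_cring: "cring Z_half"
proof (rule cringI)
  show "abelian_group Z_half"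
  proof (rule abelian_groupI)
    fix x assume "x \<in> carrier Z_half"
    then show "\<exists>y \<in> carrier Z_half. y \<oplus>\<^bsub>Z_half\<^esub> x = \<zero>\<^bsub>Z_half\<^esub>"
      by (intro bexI[of _ "- x"]) simp_all
  qed simp_all
  show "comm_monoid Z_half"
    by (rule comm_monoidI) simp_all
qed (simp add: algebra_simps)

text \<open>An additive map commutes with integer multiples. For \<open>r = k / 2^n\<close> the two
  sides agree after multiplication by \<open>2^n\<close>, which is invertible on \<open>N\<close>.
  Applied to the identity map, this shows that the addition determines the scalar action.\<close>

lemma additive_imp_Z_half_linear:
  assumes "module Z_half M" "module Z_half N"
    and \<phi>_closed [simp]: "\<And>x. x \<in> carrier M \<Longrightarrow> \<phi> x \<in> carrier N"
    and add: "\<And>x y. \<lbrakk>x \<in> carrier M; y \<in> carrier M\<rbrakk> \<Longrightarrow> \<phi> (x \<oplus>\<^bsub>M\<^esub> y) = \<phi> x \<oplus>\<^bsub>N\<^esub> \<phi> y"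
    and r: "r \<in> carrier Z_half" and x: "x \<in> carrier M"
  shows "\<phi> (r \<odot>\<^bsub>M\<^esub> x) = r \<odot>\<^bsub>N\<^esub> \<phi> x"
proof -
  interpret M: module Z_half M by fact
  interpret N: module Z_half N by fact
  have M0: "0 \<odot>\<^bsub>M\<^esub> y = \<zero>\<^bsub>M\<^esub>" if "y \<in> carrier M" for y using M.smult_l_null[OF that] by simp
  have N0: "0 \<odot>\<^bsub>N\<^esub> y = \<zero>\<^bsub>N\<^esub>" if "y \<in> carrier N" for y using N.smult_l_null[OF that] by simp
  have zero: "\<phi> \<zero>\<^bsub>M\<^esub> = \<zero>\<^bsub>N\<^esub>"
    using add[of "\<zero>\<^bsub>M\<^esub>" "\<zero>\<^bsub>M\<^esub>"] by simp
  have nat: "\<phi> (of_nat k \<odot>\<^bsub>M\<^esub> y) = of_nat k \<odot>\<^bsub>N\<^esub> \<phi> y" if "y \<in> carrier M" for k y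
  proof (induction k)
    case 0
    then show ?case using that by (simp add: M0 N0 zero)
  next
    case (Suc k)
    have [simp]: "of_nat k \<in> carrier Z_half" using Z_half_of_int[of "int k"] by simp
    show ?case
      using that Suc M.smult_l_distr[of 1 "of_nat k" y] N.smult_l_distr[of 1 "of_nat k" "\<phi> y"]
        M.smult_one[of y] N.smult_one[of "\<phi> y"] by (simp add: add)
  qed
  have int: "\<phi> (of_int k \<odot>\<^bsub>M\<^esub> y) = of_int k \<odot>\<^bsub>N\<^esub> \<phi> y" if y: "y \<in> carrier M" for k y
  proof (cases k)
    case (neg n)
    \<comment> \<open>For negative \<open>k\<close>, both candidates for the image of
      \<open>(- m) y\<close> are additive inverses of \<open>m\<close> times
      \<open>\<phi> y\<close>.\<close>
    define m :: rat where "m = of_nat (Suc n)"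
    have k: "of_int k = - m" by (simp add: m_def neg)
    have [simp]: "m \<in> carrier Z_half" using Z_half_of_int[of "int (Suc n)"] by (simp add: m_def)
    have inv: "(- m) \<odot>\<^bsub>M\<^esub> y \<oplus>\<^bsub>M\<^esub> m \<odot>\<^bsub>M\<^esub> y = \<zero>\<^bsub>M\<^esub>" "(- m) \<odot>\<^bsub>N\<^esub> \<phi> y \<oplus>\<^bsub>N\<^esub> m \<odot>\<^bsub>N\<^esub> \<phi> y = \<zero>\<^bsub>N\<^esub>"
      using M.smult_l_distr[of "- m" m y] N.smult_l_distr[of "- m" m "\<phi> y"] y by (simp_all add: M0 N0)
    have "\<phi> ((- m) \<odot>\<^bsub>M\<^esub> y) \<oplus>\<^bsub>N\<^esub> m \<odot>\<^bsub>N\<^esub> \<phi> y = (- m) \<odot>\<^bsub>N\<^esub> \<phi> y \<oplus>\<^bsub>N\<^esub> m \<odot>\<^bsub>N\<^esub> \<phi> y"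
      using add[of "(- m) \<odot>\<^bsub>M\<^esub> y" "m \<odot>\<^bsub>M\<^esub> y", symmetric] nat[OF y, of "Suc n", folded m_def] y
      by (simp add: inv zero)
    then show ?thesis unfolding k using y by simp
  qed (use nat[OF y] in simp)
  obtain k n where k: "r * 2 ^ n = of_int k" using r by (auto simp: Z_half_carrier)
  have k': "2 ^ n * r = of_int k" using k by (simp add: mult.commute)
  have "2 ^ n \<odot>\<^bsub>N\<^esub> \<phi> (r \<odot>\<^bsub>M\<^esub> x) = \<phi> (2 ^ n \<odot>\<^bsub>M\<^esub> (r \<odot>\<^bsub>M\<^esub> x))"
    using int[of "r \<odot>\<^bsub>M\<^esub> x" "2 ^ n"] r x by simp
  also have "2 ^ n \<odot>\<^bsub>M\<^esub> (r \<odot>\<^bsub>M\<^esub> x) = of_int k \<odot>\<^bsub>M\<^esub> x"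
    using M.smult_assoc1[of "2 ^ n" r x] r x k' by simp
  also have "\<phi> (of_int k \<odot>\<^bsub>M\<^esub> x) = 2 ^ n \<odot>\<^bsub>N\<^esub> (r \<odot>\<^bsub>N\<^esub> \<phi> x)"
    using N.smult_assoc1[of "2 ^ n" r "\<phi> x"] r x k' int[OF x] by simp
  finally have "(1 / 2 ^ n) \<odot>\<^bsub>N\<^esub> (2 ^ n \<odot>\<^bsub>N\<^esub> \<phi> (r \<odot>\<^bsub>M\<^esub> x)) = (1 / 2 ^ n) \<odot>\<^bsub>N\<^esub> (2 ^ n \<odot>\<^bsub>N\<^esub> (r \<odot>\<^bsub>N\<^esub> \<phi> x))"
    by simp
  moreover have "(1 / 2 ^ n) \<odot>\<^bsub>N\<^esub> (2 ^ n \<odot>\<^bsub>N\<^esub> y) = y" if "y \<in> carrier N" for y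
    using that N.smult_assoc1[of "1 / 2 ^ n" "2 ^ n" y] N.smult_one[of y] by simp
  ultimately show ?thesis using r x by simp
qed

lemma half_add_half:
  assumes "module Z_half M" "x \<in> carrier M"
  shows "(1 / 2) \<odot>\<^bsub>M\<^esub> x \<oplus>\<^bsub>M\<^esub> (1 / 2) \<odot>\<^bsub>M\<^esub> x = x"
proof -
  interpret module Z_half M by fact
  show ?thesis
    using smult_l_distr[of "1 / 2" "1 / 2" x] smult_one[of x] assms(2) by simp
qed

text \<open>The value \<open>y = r x\<close> is pinned down by \<open>2^n y = k x\<close> for one, equivalently every,
  representation \<open>r = k / 2^n\<close>.\<close>

definition dyadic_pow :: "('a, 'm) monoid_scheme \<Rightarrow> rat \<Rightarrow> 'a \<Rightarrow> 'a" where
  "dyadic_pow A r x = (THE y. y \<in> carrier A \<and>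
     (\<forall>n k. r * 2 ^ n = of_int k \<longrightarrow> y [^]\<^bsub>A\<^esub> (2 ^ n :: int) = x [^]\<^bsub>A\<^esub> (k :: int)))"

section \<open>The action of Z[1/2] on a uniquely 2-divisible abelian group\<close>

locale divisible_comm_group = comm_group A for A (structure) +
  assumes divisible: "uniquely_2_divisible A"
begin

lemma bij_pow_2: "bij_betw (\<lambda>x. x [^] (2 ^ n :: int)) (carrier A) (carrier A)"
proof (induction n)
  case 0
  have "bij_betw (\<lambda>x. x) (carrier A) (carrier A)" by (simp add: bij_betw_def)
  then show ?case by (rule bij_betw_cong[THEN iffD1, rotated]) simp
next
  case (Suc n)
  have "x [^] (2 ^ n :: int) \<otimes> x [^] (2 ^ n :: int) = x [^] (2 ^ Suc n :: int)" if "x \<in> carrier A" for x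
    using that by (simp flip: int_pow_mult)
  then show ?case
    using bij_betw_trans[OF Suc divisible[unfolded uniquely_2_divisible_def]]
    by (subst bij_betw_cong) (auto simp: o_def)
qed

lemma pow_2_inj:
  "\<lbrakk>x [^] (2 ^ n :: int) = y [^] (2 ^ n :: int); x \<in> carrier A; y \<in> carrier A\<rbrakk> \<Longrightarrow> x = y"
  using bij_pow_2[of n] by (auto simp: bij_betw_def inj_on_def)

text \<open>If \<open>k / 2^n = l / 2^m\<close> then \<open>k 2^m = l 2^n\<close>, so the two sides
  have the same \<open>2^n\<close>-th power, and taking \<open>2^n\<close>-th powers is
  injective.\<close>

lemma dyadic_repr_unique:
  fixes r :: rat
  assumes "x \<in> carrier A" "y \<in> carrier A" "y [^] (2 ^ n :: int) = x [^] (k :: int)"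
    and "r * 2 ^ n = of_int k" "r * 2 ^ m = of_int l"
  shows "y [^] (2 ^ m :: int) = x [^] (l :: int)"
proof -
  have "of_int (k * 2 ^ m) = (of_int (l * 2 ^ n) :: rat)"
    using assms(4,5)[symmetric] by simp
  then have kl: "k * 2 ^ m = l * 2 ^ n" by (simp only: of_int_eq_iff)
  have "(y [^] (2 ^ m :: int)) [^] (2 ^ n :: int) = (y [^] (2 ^ n :: int)) [^] (2 ^ m :: int)"
    using assms(1,2) by (simp add: int_pow_pow mult.commute)
  also have "\<dots> = (x [^] l) [^] (2 ^ n :: int)"
    using assms(1-3) kl by (simp add: int_pow_pow)
  finally show ?thesis by (rule pow_2_inj) (use assms in simp_all)
qed

text \<open>With this, every law of the scalar action reduces to one identity of integer powers over
  a common denominator.\<close>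

lemma dyadic_pow_eqI:
  assumes "x \<in> carrier A" "y \<in> carrier A" "r * 2 ^ n = of_int k"
    and "y [^] (2 ^ n :: int) = x [^] (k :: int)"
  shows "dyadic_pow A r x = y"
  unfolding dyadic_pow_def
proof (rule the_equality)
  show "y \<in> carrier A \<and> (\<forall>n k. r * 2 ^ n = of_int k \<longrightarrow> y [^] (2 ^ n :: int) = x [^] (k :: int))"
    by (intro conjI allI impI dyadic_repr_unique[OF assms(1,2,4,3)] assms(2))
  fix z assume z: "z \<in> carrier A \<and> (\<forall>n k. r * 2 ^ n = of_int k \<longrightarrow> z [^] (2 ^ n :: int) = x [^] (k :: int))"
  show "z = y"
    by (rule pow_2_inj[of z n y])
      (simp_all only: z[THEN conjunct1] z[THEN conjunct2, rule_format, OF assms(3)] assms(2,4))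
qed

lemma dyadic_pow_char:
  assumes "r \<in> carrier Z_half" "x \<in> carrier A"
  shows "dyadic_pow A r x \<in> carrier A"
    and "r * 2 ^ n = of_int k \<Longrightarrow> dyadic_pow A r x [^] (2 ^ n :: int) = x [^] (k :: int)"
proof -
  obtain k' n' where k': "r * 2 ^ n' = of_int k'" using assms by (auto simp: Z_half_carrier)
  \<comment> \<open>Existence of the dyadic power is surjectivity of the \<open>2^n'\<close>-th
    power map.\<close>
  have "x [^] k' \<in> (\<lambda>x. x [^] (2 ^ n' :: int)) ` carrier A"
    using int_pow_closed[OF assms(2)] by (simp only: bij_betw_imp_surj_on[OF bij_pow_2])
  then obtain y where y: "y [^] (2 ^ n' :: int) = x [^] k'" "y \<in> carrier A"
    by (auto intro: sym)
  have eq: "dyadic_pow A r x = y" by (rule dyadic_pow_eqI[OF assms(2) y(2) k' y(1)])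
  show "dyadic_pow A r x \<in> carrier A" by (simp only: eq y(2))
  show "dyadic_pow A r x [^] (2 ^ n :: int) = x [^] k" if "r * 2 ^ n = of_int k"
    unfolding eq by (rule dyadic_repr_unique[OF assms(2) y(2,1) k' that])
qed

lemma dyadic_pow_add:
  assumes "r \<in> carrier Z_half" "s \<in> carrier Z_half" "x \<in> carrier A"
  shows "dyadic_pow A (r + s) x = dyadic_pow A r x \<otimes> dyadic_pow A s x"
proof -
  obtain k n l m where rs: "r * 2 ^ n = of_int k" "s * 2 ^ m = of_int l"
    using assms by (auto simp: Z_half_carrier)
  note c = dyadic_pow_char[OF assms(1,3)] dyadic_pow_char[OF assms(2,3)]
  show ?thesis
  proof (rule dyadic_pow_eqI)
    show "(r + s) * 2 ^ (n + m) = of_int (k * 2 ^ m + l * 2 ^ n)"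
      using rs[symmetric] by (simp add: power_add algebra_simps)
    have "(dyadic_pow A r x \<otimes> dyadic_pow A s x) [^] (2 ^ (n + m) :: int) =
        (dyadic_pow A r x [^] (2 ^ n :: int)) [^] (2 ^ m :: int) \<otimes>
        (dyadic_pow A s x [^] (2 ^ m :: int)) [^] (2 ^ n :: int)"
      using assms c(1,3) by (simp add: int_pow_distrib int_pow_pow power_add mult.commute)
    also have "\<dots> = x [^] (k * 2 ^ m + l * 2 ^ n)"
      using assms c(1,3) c(2)[OF rs(1)] c(4)[OF rs(2)] by (simp add: int_pow_pow int_pow_mult)
    finally show "(dyadic_pow A r x \<otimes> dyadic_pow A s x) [^] (2 ^ (n + m) :: int) = \<dots>" .
  qed (use assms c(1,3) in simp_all)
qed

lemma dyadic_pow_mult: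
  assumes "r \<in> carrier Z_half" "x \<in> carrier A" "y \<in> carrier A"
  shows "dyadic_pow A r (x \<otimes> y) = dyadic_pow A r x \<otimes> dyadic_pow A r y"
proof -
  obtain k n where r: "r * 2 ^ n = of_int k"
    using assms by (auto simp: Z_half_carrier)
  note c = dyadic_pow_char[OF assms(1,2)] dyadic_pow_char[OF assms(1,3)]
  show ?thesis
    by (rule dyadic_pow_eqI[OF _ _ r])
      (use assms c(1,3) c(2)[OF r] c(4)[OF r] in \<open>simp_all add: int_pow_distrib\<close>)
qed

lemma dyadic_pow_pow:
  assumes "r \<in> carrier Z_half" "s \<in> carrier Z_half" "x \<in> carrier A"
  shows "dyadic_pow A (r * s) x = dyadic_pow A r (dyadic_pow A s x)"
proof -
  obtain k n l m where rs: "r * 2 ^ n = of_int k" "s * 2 ^ m = of_int l"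
    using assms by (auto simp: Z_half_carrier)
  note c = dyadic_pow_char[OF assms(2,3)]
  note d = dyadic_pow_char[OF assms(1) c(1)]
  show ?thesis
  proof (rule dyadic_pow_eqI)
    show "(r * s) * 2 ^ (n + m) = of_int (l * k)"
      using rs[symmetric] by (simp add: power_add algebra_simps)
    have "dyadic_pow A r (dyadic_pow A s x) [^] (2 ^ (n + m) :: int) =
        (dyadic_pow A r (dyadic_pow A s x) [^] (2 ^ n :: int)) [^] (2 ^ m :: int)"
      using d(1) by (simp add: int_pow_pow power_add)
    also have "\<dots> = (dyadic_pow A s x [^] (2 ^ m :: int)) [^] k"
      using c(1) d(1) d(2)[OF rs(1)] by (simp add: int_pow_pow mult.commute)
    also have "\<dots> = x [^] (l * k)"
      using assms c(1) c(2)[OF rs(2)] by (simp add: int_pow_pow)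
    finally show "dyadic_pow A r (dyadic_pow A s x) [^] (2 ^ (n + m) :: int) = \<dots>" .
  qed (use assms d(1) in simp_all)
qed

lemma dyadic_pow_one: "x \<in> carrier A \<Longrightarrow> dyadic_pow A 1 x = x"
  by (rule dyadic_pow_eqI[of _ _ _ 0 1]) simp_all

lemma dyadic_pow_half:
  assumes "x \<in> carrier A" "y \<in> carrier A" "y \<otimes> y = x"
  shows "dyadic_pow A (1 / 2) x = y"
proof (rule dyadic_pow_eqI[of _ _ _ 1 1])
  show "y [^] (2 ^ 1 :: int) = x [^] (1 :: int)"
    using assms int_pow_mult[of y 1 1] by simp
qed (use assms in simp_all)

end

section \<open>The exponential\<close>

lemma nil2_lie_bracket_derived:
  assumes "nil2_lie L" "x \<in> carrier L" "c \<in> lie_derived Z_half L"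
  shows "bracket L x c = \<zero>\<^bsub>L\<^esub>" "bracket L c x = \<zero>\<^bsub>L\<^esub>"
proof -
  interpret lie_algebra Z_half L using assms by (simp add: nil2_lie_def)
  have c: "c \<in> carrier L" using submoduleE(1)[OF lie_derived_submodule] assms by blast
  show *: "bracket L x c = \<zero>\<^bsub>L\<^esub>" using assms by (simp add: nil2_lie_def)
  show "bracket L c x = \<zero>\<^bsub>L\<^esub>" using bracket_anticomm[OF c assms(2)] * by simp
qed

definition half_bracket :: "(rat, 'a) lie_alg \<Rightarrow> 'a \<Rightarrow> 'a \<Rightarrow> 'a" where
  "half_bracket L x y = (1 / 2) \<odot>\<^bsub>L\<^esub> bracket L x y"

lemma exp_central_bimult:
  assumes "nil2_lie L"
  shows "central_bimult (add_monoid L) (lie_derived Z_half L) (half_bracket L)"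
proof -
  interpret lie_algebra Z_half L using assms by (simp add: nil2_lie_def)
  show ?thesis
    by (intro central_bimult.intro lie_central_subgroup central_bimult_axioms.intro)
      (simp_all add: assms half_bracket_def bracket_add_left bracket_add_right bracket_closed smult_r_distr
        nil2_lie_bracket_derived submoduleE(4)[OF lie_derived_submodule] bracket_in_lie_derived)
qed

lemma exp_group_twist: "exp_group L = twist (add_monoid L) (half_bracket L)"
  by (simp add: exp_group_def twist_def half_bracket_def)

lemma exp_carrier [simp]: "carrier (exp_group L) = carrier L"
  by (simp add: exp_group_def)

lemma exp_group_group: "nil2_lie L \<Longrightarrow> group (exp_group L)"
  unfolding exp_group_twist by (rule central_bimult.twist_group[OF exp_central_bimult])

lemma exp_mult:
  "\<lbrakk>x \<in> carrier L; y \<in> carrier L\<rbrakk> \<Longrightarrow>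
    x \<otimes>\<^bsub>exp_group L\<^esub> y = x \<oplus>\<^bsub>L\<^esub> y \<oplus>\<^bsub>L\<^esub> half_bracket L x y"
  by (simp add: exp_group_twist twist_mult)

lemma exp_double:
  assumes "nil2_lie L" "x \<in> carrier L"
  shows "x \<otimes>\<^bsub>exp_group L\<^esub> x = x \<oplus>\<^bsub>L\<^esub> x"
proof -
  interpret lie_algebra Z_half L using assms by (simp add: nil2_lie_def)
  show ?thesis using assms by (simp add: exp_mult half_bracket_def bracket_self)
qed

text \<open>The products of \<open>x\<close> and \<open>y\<close> in the two orders are
  \<open>x + y\<close> plus or minus half the bracket, so they differ by \<open>[x, y]\<close>. This
  element lies in \<open>[L, L]\<close>, where multiplying in the exponential group means
  adding.\<close>

lemma exp_commutator:
  assumes "nil2_lie L" and [simp]: "x \<in> carrier L" "y \<in> carrier L"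
  shows "commutator (exp_group L) x y = bracket L x y"
proof -
  interpret lie_algebra Z_half L using assms by (simp add: nil2_lie_def)
  interpret T: central_bimult "add_monoid L" "lie_derived Z_half L" "half_bracket L"
    by (rule exp_central_bimult) fact
  let ?h = "half_bracket L x y"
  have [simp]: "bracket L x y \<in> carrier L" "?h \<in> carrier L" by (simp_all add: bracket_closed half_bracket_def)
  have anti: "half_bracket L y x = \<ominus>\<^bsub>L\<^esub> ?h"
    unfolding half_bracket_def bracket_anticomm[of y x, OF assms(3,2)]
    by (simp add: smult_r_minus)
  have split: "bracket L x y = ?h \<oplus>\<^bsub>L\<^esub> ?h"
    using half_add_half[OF module_axioms, of "bracket L x y"] by (simp add: half_bracket_def)
  have "bracket L x y \<otimes>\<^bsub>exp_group L\<^esub> (y \<otimes>\<^bsub>exp_group L\<^esub> x) = bracket L x y \<oplus>\<^bsub>L\<^esub> (y \<otimes>\<^bsub>exp_group L\<^esub> x)"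
    using T.twist_mult_D(2)[of "bracket L x y" "y \<otimes>\<^bsub>exp_group L\<^esub> x"]
    by (simp add: exp_group_twist bracket_in_lie_derived T.twist_closed[simplified])
  also have "\<dots> = x \<oplus>\<^bsub>L\<^esub> y \<oplus>\<^bsub>L\<^esub> ?h \<oplus>\<^bsub>L\<^esub> (\<ominus>\<^bsub>L\<^esub> ?h \<oplus>\<^bsub>L\<^esub> ?h)"
    by (simp add: exp_mult anti split a_ac del: l_neg)
  also have "\<dots> = x \<otimes>\<^bsub>exp_group L\<^esub> y"
    by (simp add: exp_mult l_neg)
  finally show ?thesis
    by (intro group.commutator_eqI[OF exp_group_group[OF assms(1)]]) simp_all
qed

text \<open>Commutators are brackets, but one side is the generated subgroup and the other the
  generated submodule. They agree because the set of brackets is closed under scalars, as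
  \<open>r [x, y] = [r x, y]\<close>.\<close>

lemma exp_derived:
  assumes "nil2_lie L"
  shows "derived (exp_group L) (carrier L) = lie_derived Z_half L" (is "?D = ?E")
proof
  interpret lie_algebra Z_half L using assms by (simp add: nil2_lie_def)
  interpret T: central_bimult "add_monoid L" ?E "half_bracket L"
    by (rule exp_central_bimult) fact
  interpret X: group "exp_group L" by (rule exp_group_group) fact
  interpret E: central_subgroup "exp_group L" ?E
    unfolding exp_group_twist by (rule T.twist_central_subgroup)
  show DE: "?D \<subseteq> ?E"
    using X.derived_subset[OF E.D_subgroup]
    by (simp add: exp_commutator assms bracket_in_lie_derived)
  have D: "subgroup ?D (exp_group L)" using X.derived_is_subgroup by simp
  have Dc: "c \<in> carrier L" if "c \<in> ?D" for c using subgroup.mem_carrier[OF D that] by simp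
  \<comment> \<open>The half bracket vanishes on \<open>?E\<close>, so there the group structures of
    \<open>L\<close> and \<open>exp_group L\<close> coincide.\<close>
  have add: "c \<oplus>\<^bsub>L\<^esub> d = c \<otimes>\<^bsub>exp_group L\<^esub> d" if "c \<in> ?E" "d \<in> ?E" for c d
    using T.twist_mult_D(1)[of d c] T.D_carrier[of c] that by (simp add: exp_group_twist)
  have neg: "\<ominus>\<^bsub>L\<^esub> c = inv\<^bsub>exp_group L\<^esub> c" if "c \<in> ?E" for c
    using T.twist_inv_D[of c] that by (simp add: exp_group_twist a_inv_def)
  \<comment> \<open>Closure under scalars is checked on generators: the elements of
    \<open>?D\<close> all of whose multiples stay in \<open>?D\<close> form a subgroup containing
    every commutator.\<close>
  have "?D \<subseteq> {c \<in> ?D. \<forall>r \<in> carrier Z_half. r \<odot>\<^bsub>L\<^esub> c \<in> ?D}" (is "_ \<subseteq> ?K")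
  proof -
    have "derived (exp_group L) (carrier (exp_group L)) \<subseteq> ?K"
    proof (rule X.derived_subset)
      show "subgroup ?K (exp_group L)"
      proof (rule X.subgroupI)
        show "?K \<subseteq> carrier (exp_group L)" using Dc by auto
        have "\<zero>\<^bsub>L\<^esub> \<in> ?K" using subgroup.one_closed[OF D] by (simp add: exp_group_def)
        then show "?K \<noteq> {}" by blast
        have K: "c \<in> carrier L" "c \<in> ?E" "r \<in> carrier Z_half \<Longrightarrow> r \<odot>\<^bsub>L\<^esub> c \<in> ?E" if "c \<in> ?K" for r c
          using that DE Dc by auto
        fix c assume c: "c \<in> ?K"
        have "r \<odot>\<^bsub>L\<^esub> (inv\<^bsub>exp_group L\<^esub> c) = inv\<^bsub>exp_group L\<^esub> (r \<odot>\<^bsub>L\<^esub> c)" if "r \<in> carrier Z_half" for r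
          using smult_r_minus[OF that K(1)[OF c]]
          by (simp only: neg[OF K(2)[OF c]] neg[OF K(3)[OF c that]])
        then show "inv\<^bsub>exp_group L\<^esub> c \<in> ?K"
          using c subgroup.m_inv_closed[OF D] by simp
        fix d assume d: "d \<in> ?K"
        have "r \<odot>\<^bsub>L\<^esub> (c \<otimes>\<^bsub>exp_group L\<^esub> d) = (r \<odot>\<^bsub>L\<^esub> c) \<otimes>\<^bsub>exp_group L\<^esub> (r \<odot>\<^bsub>L\<^esub> d)" if "r \<in> carrier Z_half" for r
          using smult_r_distr[OF that K(1)[OF c] K(1)[OF d]]
          by (simp only: add[OF K(2)[OF c] K(2)[OF d]] add[OF K(3)[OF c that] K(3)[OF d that]])
        then show "c \<otimes>\<^bsub>exp_group L\<^esub> d \<in> ?K"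
          using c d subgroup.m_closed[OF D] by simp
      qed
      fix x y assume xy: "x \<in> carrier (exp_group L)" "y \<in> carrier (exp_group L)"
      have comm: "bracket L x' y' \<in> ?D" if "x' \<in> carrier L" "y' \<in> carrier L" for x' y'
        using commutator_in_derived[of x' "exp_group L" y'] that by (simp add: exp_commutator assms)
      show "commutator (exp_group L) x y \<in> ?K"
        using xy comm comm[of "_ \<odot>\<^bsub>L\<^esub> x" y]
        by (simp add: exp_commutator assms flip: bracket_smult_left)
    qed
    then show ?thesis by simp
  qed
  then have smult: "r \<odot>\<^bsub>L\<^esub> c \<in> ?D" if "c \<in> ?D" "r \<in> carrier Z_half" for r c
    using that by auto
  show "?E \<subseteq> ?D"
  proof (rule lie_derived_minimal)
    show "submodule ?D Z_half L"
    proof (rule submoduleI)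
      show "\<zero>\<^bsub>L\<^esub> \<in> ?D" using subgroup.one_closed[OF D] by (simp add: exp_group_def)
    qed (use DE Dc smult in \<open>auto simp: add neg subsetD subgroup.m_closed[OF D] subgroup.m_inv_closed[OF D]\<close>)
    fix x y assume "x \<in> carrier L" "y \<in> carrier L"
    then show "bracket L x y \<in> ?D"
      using commutator_in_derived[of x "exp_group L" y] by (simp add: exp_commutator assms)
  qed
qed

lemma exp_nil2_group:
  assumes "nil2_lie L"
  shows "nil2_group (exp_group L)"
  unfolding nil2_group_def
proof (intro conjI ballI exp_group_group assms)
  interpret T: central_bimult "add_monoid L" "lie_derived Z_half L" "half_bracket L"
    by (rule exp_central_bimult) fact
  fix c x assume "c \<in> derived (exp_group L) (carrier (exp_group L))" "x \<in> carrier (exp_group L)"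
  then have c: "c \<in> lie_derived Z_half L" and x: "x \<in> carrier L"
    by (simp_all add: exp_derived assms)
  then have "commutator (exp_group L) c x = bracket L c x"
    using T.D_carrier[of c] by (simp add: exp_commutator assms)
  then show "commutator (exp_group L) c x = \<one>\<^bsub>exp_group L\<^esub>"
    using nil2_lie_bracket_derived(2)[OF assms x c] by (simp add: exp_group_def)
qed

text \<open>As \<open>[x, x] = 0\<close>, squaring in the group is doubling in \<open>L\<close>,
  with inverse the scalar \<open>1/2\<close>.\<close>

lemma exp_uniquely_2_divisible:
  assumes "nil2_lie L"
  shows "uniquely_2_divisible (exp_group L)"
proof -
  interpret lie_algebra Z_half L using assms by (simp add: nil2_lie_def)
  show ?thesis unfolding uniquely_2_divisible_def exp_carrier
  proof (rule bij_betw_byWitness[where f' = "\<lambda>x. (1 / 2) \<odot>\<^bsub>L\<^esub> x"])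
    show "\<forall>x \<in> carrier L. (1 / 2) \<odot>\<^bsub>L\<^esub> (x \<otimes>\<^bsub>exp_group L\<^esub> x) = x"
      by (simp add: exp_double assms smult_r_distr half_add_half[OF module_axioms])
    show "\<forall>x \<in> carrier L. ((1 / 2) \<odot>\<^bsub>L\<^esub> x) \<otimes>\<^bsub>exp_group L\<^esub> ((1 / 2) \<odot>\<^bsub>L\<^esub> x) = x"
      by (simp add: exp_double assms half_add_half[OF module_axioms])
  qed (auto simp: exp_double assms)
qed

lemma exp_extensional_monoid: "extensional_monoid (exp_group L)"
  unfolding extensional_monoid_def exp_group_def by (auto intro!: ext simp: restrict_def)

text \<open>By \<open>exp_derived\<close> both sides are relative q-maps for the same
  \<open>D\<close> and \<open>E\<close>, once for the twisted and once for the additive groups, so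
  invariance under twisting applies.\<close>

lemma exp_qmap_iff:
  assumes "nil2_lie L" "nil2_lie L'"
  shows "group_qmap (exp_group L) (exp_group L') f \<longleftrightarrow> lie_qmap L L' f"
  unfolding group_qmap_iff[OF assms[THEN exp_nil2_group]] lie_qmap_iff[OF assms]
  unfolding exp_carrier assms[THEN exp_derived] unfolding exp_group_twist
  by (rule qmap_twist_iff) (intro exp_central_bimult assms)+

lemma exp_lie_hom:
  assumes "nil2_lie L" "nil2_lie L'" "lie_hom L L' f"
  shows "f \<in> hom (exp_group L) (exp_group L')"
proof -
  interpret lie_algebra Z_half L using assms by (simp add: nil2_lie_def)
  show ?thesis
    using assms(3)
    by (intro homI) (auto simp: lie_hom_def exp_mult half_bracket_def bracket_closed Pi_iff)
qed

section \<open>Recovering a Lie algebra from its exponential group\<close>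

lemma extensional_lie_eqI:
  assumes "extensional_lie L" "extensional_lie L'" "carrier L = carrier L'" "\<zero>\<^bsub>L\<^esub> = \<zero>\<^bsub>L'\<^esub>"
    and "\<And>x y. \<lbrakk>x \<in> carrier L; y \<in> carrier L\<rbrakk> \<Longrightarrow> x \<oplus>\<^bsub>L\<^esub> y = x \<oplus>\<^bsub>L'\<^esub> y"
    and "\<And>r x. \<lbrakk>r \<in> carrier Z_half; x \<in> carrier L\<rbrakk> \<Longrightarrow> r \<odot>\<^bsub>L\<^esub> x = r \<odot>\<^bsub>L'\<^esub> x"
    and "\<And>x y. \<lbrakk>x \<in> carrier L; y \<in> carrier L\<rbrakk> \<Longrightarrow> bracket L x y = bracket L' x y"
  shows "L = L'"
proof -
  have "add L = (\<lambda>x \<in> carrier L. \<lambda>y \<in> carrier L. x \<oplus>\<^bsub>L\<^esub> y)"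
    using assms(1) by (simp only: extensional_lie_def)
  also have "\<dots> = (\<lambda>x \<in> carrier L'. \<lambda>y \<in> carrier L'. x \<oplus>\<^bsub>L'\<^esub> y)"
    using assms(3,5) by (auto intro!: restrict_ext)
  also have "\<dots> = add L'"
    using assms(2) by (simp only: extensional_lie_def)
  finally have a: "add L = add L'" .
  have "smult L = (\<lambda>r \<in> carrier Z_half. \<lambda>x \<in> carrier L. r \<odot>\<^bsub>L\<^esub> x)"
    using assms(1) by (simp only: extensional_lie_def)
  also have "\<dots> = (\<lambda>r \<in> carrier Z_half. \<lambda>x \<in> carrier L'. r \<odot>\<^bsub>L'\<^esub> x)"
    using assms(3,6) by (auto intro!: restrict_ext)
  also have "\<dots> = smult L'"
    using assms(2) by (simp only: extensional_lie_def)
  finally have s: "smult L = smult L'" .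
  have "bracket L = (\<lambda>x \<in> carrier L. \<lambda>y \<in> carrier L. bracket L x y)"
    using assms(1) by (simp only: extensional_lie_def)
  also have "\<dots> = (\<lambda>x \<in> carrier L'. \<lambda>y \<in> carrier L'. bracket L' x y)"
    using assms(3,7) by (auto intro!: restrict_ext)
  also have "\<dots> = bracket L'"
    using assms(2) by (simp only: extensional_lie_def)
  finally have b: "bracket L = bracket L'" .
  have m: "mult L = mult L'" "one L = one L'"
    using assms(1,2) by (simp_all add: extensional_lie_def)
  show ?thesis by (rule lie_alg.equality) (simp_all add: a s b m assms(3,4))
qed

text \<open>This is the untwisting identity read as a formula for the addition in terms of the group
  and the half bracket.\<close>

lemma add_eq_exp_mult:
  assumes "nil2_lie L" and [simp]: "x \<in> carrier L" "y \<in> carrier L"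
  shows "x \<oplus>\<^bsub>L\<^esub> y = x \<otimes>\<^bsub>exp_group L\<^esub> y \<otimes>\<^bsub>exp_group L\<^esub> inv\<^bsub>exp_group L\<^esub> (half_bracket L x y)"
proof -
  interpret T: central_bimult "add_monoid L" "lie_derived Z_half L" "half_bracket L"
    by (rule exp_central_bimult) fact
  have h: "half_bracket L x y \<in> lie_derived Z_half L"
    using T.bm_closed[of x y] by simp
  show ?thesis
    using T.untwist_mult[of x y]
    by (simp add: exp_group_twist twist_mult[of _ "twist _ _"] T.twist_inv_D[OF h])
qed

text \<open>The group determines all of \<open>L\<close>: the bracket is the commutator, the half
  bracket is its unique square root, the addition follows by untwisting, and the addition determines
  the scalars.\<close>

lemma exp_group_inj:
  assumes L: "nil2_lie L" "extensional_lie L" and L': "nil2_lie L'" "extensional_lie L'"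
    and eq: "exp_group L = exp_group L'"
  shows "L = L'"
proof -
  interpret L: lie_algebra Z_half L using L by (simp add: nil2_lie_def)
  interpret L': lie_algebra Z_half L' using L' by (simp add: nil2_lie_def)
  have car: "carrier L = carrier L'" using arg_cong[OF eq, of carrier] by simp
  have zero: "\<zero>\<^bsub>L\<^esub> = \<zero>\<^bsub>L'\<^esub>" using arg_cong[OF eq, of one] by (simp add: exp_group_def)
  have br: "bracket L x y = bracket L' x y" if "x \<in> carrier L" "y \<in> carrier L" for x y
    using exp_commutator[OF L(1) that] exp_commutator[OF L'(1) that[unfolded car]] unfolding eq by simp
  have half: "half_bracket L x y = half_bracket L' x y" if xy: "x \<in> carrier L" "y \<in> carrier L" for x y
  proof -
    let ?h = "half_bracket L x y" and ?h' = "half_bracket L' x y"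
    have h: "?h \<in> carrier L" "?h' \<in> carrier L'"
      using xy xy[unfolded car] by (simp_all add: half_bracket_def L.bracket_closed L'.bracket_closed)
    have "?h \<otimes>\<^bsub>exp_group L\<^esub> ?h = bracket L x y"
      unfolding exp_double[OF L(1) h(1)]
      unfolding half_bracket_def by (rule half_add_half[OF L.module_axioms L.bracket_closed[OF xy]])
    also have "\<dots> = bracket L' x y" by (rule br[OF xy])
    also have "\<dots> = ?h' \<otimes>\<^bsub>exp_group L'\<^esub> ?h'"
      unfolding exp_double[OF L'(1) h(2)]
      unfolding half_bracket_def
      by (rule half_add_half[OF L'.module_axioms L'.bracket_closed[OF xy[unfolded car]], symmetric])
    finally have "?h \<otimes>\<^bsub>exp_group L\<^esub> ?h = ?h' \<otimes>\<^bsub>exp_group L\<^esub> ?h'" unfolding eq .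
    then show ?thesis
      using exp_uniquely_2_divisible[OF L(1)] h
      unfolding uniquely_2_divisible_def bij_betw_def inj_on_def exp_carrier car by blast
  qed
  have add: "x \<oplus>\<^bsub>L\<^esub> y = x \<oplus>\<^bsub>L'\<^esub> y" if xy: "x \<in> carrier L" "y \<in> carrier L" for x y
  proof -
    have xy': "x \<in> carrier L'" "y \<in> carrier L'" using xy car by simp_all
    show ?thesis
      unfolding add_eq_exp_mult[OF L(1) xy] add_eq_exp_mult[OF L'(1) xy'] half[OF xy] eq ..
  qed
  \<comment> \<open>The identity map is additive from \<open>L\<close> to \<open>L'\<close>, hence
    linear.\<close>
  have "r \<odot>\<^bsub>L\<^esub> x = r \<odot>\<^bsub>L'\<^esub> x" if "r \<in> carrier Z_half" "x \<in> carrier L" for r x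
    by (rule additive_imp_Z_half_linear[OF L.module_axioms L'.module_axioms _ _ that, of "\<lambda>x. x"])
      (simp_all add: car add)
  then show ?thesis
    by (intro extensional_lie_eqI[OF L(2) L'(2) car zero add _ br])
qed

section \<open>The logarithm\<close>

locale divisible_nil2_group =
  fixes G :: "('a, 'm) monoid_scheme" (structure)
  assumes nil2: "nil2_group G" and divisible: "uniquely_2_divisible G"
begin

text \<open>The center serves as \<open>D\<close> because the twist takes values in square roots of
  commutators, and the center contains the square roots of its elements
  (\<open>half_center\<close>).\<close>

definition center where "center = {c \<in> carrier G. \<forall>x \<in> carrier G. c \<otimes> x = x \<otimes> c}"

definition half where "half = inv_into (carrier G) (\<lambda>x. x \<otimes> x)"

text \<open>The reversed commutator supplies the sign: \<open>x + y = x y [x, y]^(-1/2)\<close>, the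
  inverse of the formula for \<open>exp\<close>.\<close>

definition log_defect where "log_defect x y = half (commutator G y x)"

sublocale group G using nil2 by (simp add: nil2_group_def)

sublocale central_subgroup G center
proof (intro central_subgroup.intro central_subgroup_axioms.intro is_group)
  show "subgroup center G"
  proof (rule subgroupI)
    show "center \<noteq> {}" using one_closed by (force simp: center_def)
    fix c assume c: "c \<in> center"
    have "inv c \<otimes> x = x \<otimes> inv c" if "x \<in> carrier G" for x
    proof -
      have cG: "c \<in> carrier G" and comm: "inv x \<otimes> c = c \<otimes> inv x"
        using c that by (simp_all add: center_def)
      have "inv c \<otimes> inv (inv x) = inv (inv x \<otimes> c)"
        by (rule inv_mult_group[symmetric]) (simp_all add: cG that)
      also have "\<dots> = inv (inv x) \<otimes> inv c"
        unfolding comm by (rule inv_mult_group) (simp_all add: cG that)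
      finally show ?thesis using that by simp
    qed
    then show "inv c \<in> center" using c by (simp add: center_def)
    fix d assume d: "d \<in> center"
    show "c \<otimes> d \<in> center"
    proof -
      have [simp]: "c \<in> carrier G" "d \<in> carrier G" using c d by (simp_all add: center_def)
      have "c \<otimes> d \<otimes> x = x \<otimes> (c \<otimes> d)" if [simp]: "x \<in> carrier G" for x
      proof -
        have "c \<otimes> d \<otimes> x = c \<otimes> x \<otimes> d" using d by (simp add: center_def m_assoc)
        also have "c \<otimes> x = x \<otimes> c" using c by (simp add: center_def)
        finally show ?thesis by (simp add: m_assoc)
      qed
      then show ?thesis by (simp add: center_def)
    qed
  qed (auto simp: center_def)
qed (simp add: center_def)

section \<open>Unique square roots\<close>

lemma square_image: "x \<in> carrier G \<Longrightarrow> x \<in> (\<lambda>x. x \<otimes> x) ` carrier G"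
  using bij_betw_imp_surj_on[OF divisible[unfolded uniquely_2_divisible_def]] by simp

lemma half_closed [simp]: "x \<in> carrier G \<Longrightarrow> half x \<in> carrier G"
  unfolding half_def by (rule inv_into_into[OF square_image])

lemma half_double [simp]: "x \<in> carrier G \<Longrightarrow> half x \<otimes> half x = x"
  unfolding half_def by (rule f_inv_into_f[OF square_image])

lemma half_eqI:
  assumes "x \<in> carrier G" "y \<in> carrier G" "y \<otimes> y = x"
  shows "half x = y"
  by (rule inj_onD[OF bij_betw_imp_inj_on[OF divisible[unfolded uniquely_2_divisible_def]]])
    (simp_all add: assms)

text \<open>Conjugating the root of a central \<open>c\<close> by \<open>x\<close> gives another
  root of \<open>c\<close>; by uniqueness it is the same one, so the root commutes with
  \<open>x\<close>.\<close>

lemma half_center [simp]: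
  assumes c: "c \<in> center" shows "half c \<in> center"
proof -
  have [simp]: "c \<in> carrier G" using c by simp
  have "half c \<otimes> x = x \<otimes> half c" if [simp]: "x \<in> carrier G" for x
  proof -
    have cancel: "inv x \<otimes> (x \<otimes> z) = z" "x \<otimes> (inv x \<otimes> z) = z" "half c \<otimes> (half c \<otimes> z) = c \<otimes> z"
      if "z \<in> carrier G" for z
      using that by (simp_all add: m_assoc[symmetric])
    have "(x \<otimes> half c \<otimes> inv x) \<otimes> (x \<otimes> half c \<otimes> inv x) = x \<otimes> (c \<otimes> inv x)"
      by (simp add: m_assoc cancel)
    also have "\<dots> = c"
      by (simp add: D_comm[OF c] cancel)
    finally have "half c = x \<otimes> half c \<otimes> inv x"
      by (intro half_eqI) simp_all
    moreover have "half c = x \<otimes> half c \<otimes> inv x \<longleftrightarrow> x \<otimes> half c = half c \<otimes> x"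
      by (rule inv_solve_right) simp_all
    ultimately show ?thesis by (rule iffD1[rotated, THEN sym])
  qed
  then show ?thesis
    unfolding center_def using half_closed[OF \<open>c \<in> carrier G\<close>] by blast
qed

lemma half_mult: "\<lbrakk>c \<in> center; d \<in> center\<rbrakk> \<Longrightarrow> half (c \<otimes> d) = half c \<otimes> half d"
  by (rule half_eqI) (simp_all add: D_four)

lemma half_one: "half \<one> = \<one>"
  by (rule half_eqI) simp_all

section \<open>Bimultiplicativity of the commutator\<close>

lemma commutator_center [simp]:
  assumes "x \<in> carrier G" "y \<in> carrier G" shows "commutator G x y \<in> center"
proof -
  interpret derived: central_subgroup G "derived G (carrier G)"
    by (rule nil2_central_subgroup[OF nil2])
  show ?thesis
    unfolding center_def
    using derived.D_comm[OF commutator_in_derived[OF assms]] commutator_closed[OF assms] by blast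
qed

lemma commutator_left:
  assumes [simp]: "x \<in> carrier G" "y \<in> carrier G" "z \<in> carrier G"
  shows "commutator G (x \<otimes> y) z = commutator G x z \<otimes> commutator G y z"
proof (rule commutator_eqI)
  have "x \<otimes> y \<otimes> z = x \<otimes> (commutator G y z \<otimes> (z \<otimes> y))"
    by (simp only: commutator_mult assms m_assoc)
  also have "\<dots> = commutator G y z \<otimes> (x \<otimes> z) \<otimes> y"
    using D_comm[OF commutator_center[OF assms(2,3)] assms(1)] by (simp add: m_assoc[symmetric])
  also have "\<dots> = commutator G x z \<otimes> commutator G y z \<otimes> (z \<otimes> (x \<otimes> y))"
    using D_ac(1)[OF commutator_center[OF assms(1,3)] commutator_center[OF assms(2,3)]]
    by (simp add: commutator_mult[OF assms(1,3), symmetric] m_assoc[symmetric])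
  finally show "commutator G x z \<otimes> commutator G y z \<otimes> (z \<otimes> (x \<otimes> y)) = x \<otimes> y \<otimes> z" ..
qed simp_all

lemma commutator_inv:
  "\<lbrakk>x \<in> carrier G; y \<in> carrier G\<rbrakk> \<Longrightarrow> inv (commutator G x y) = commutator G y x"
  by (simp add: commutator_def inv_mult_group m_assoc)

lemma commutator_right:
  assumes [simp]: "x \<in> carrier G" "y \<in> carrier G" "z \<in> carrier G"
  shows "commutator G x (y \<otimes> z) = commutator G x y \<otimes> commutator G x z"
proof -
  have "commutator G x (y \<otimes> z) = inv (commutator G y x \<otimes> commutator G z x)"
    by (simp add: commutator_inv flip: commutator_left)
  then show ?thesis by (simp add: inv_D_mult commutator_inv)
qed

lemma commutator_D [simp]:
  assumes "c \<in> center" "x \<in> carrier G"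
  shows "commutator G c x = \<one>" "commutator G x c = \<one>"
  using assms D_comm[OF assms] by (auto intro!: commutator_eqI)

lemma log_central_bimult: "central_bimult G center log_defect"
  by unfold_locales (simp_all add: log_defect_def commutator_left commutator_right half_mult half_one)

sublocale log: central_bimult G center log_defect by (rule log_central_bimult)

section \<open>The additive group of the logarithm\<close>

abbreviation "log_add \<equiv> twist G log_defect"

lemma log_defect_inv:
  assumes [simp]: "x \<in> carrier G" "y \<in> carrier G"
  shows "inv (log_defect x y) = log_defect y x"
proof (rule inv_equality)
  have "log_defect y x \<otimes> log_defect x y = half (commutator G x y \<otimes> inv (commutator G x y))"
    unfolding commutator_inv[OF assms] by (simp add: log_defect_def half_mult)
  also have "\<dots> = \<one>" by (simp add: half_one)
  finally show "log_defect y x \<otimes> log_defect x y = \<one>" .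
qed (simp_all add: log_defect_def)

text \<open>Squares are not affected by the twist, so unique 2-divisibility and the square roots
  themselves carry over to \<open>log_add\<close>.\<close>

lemma log_double:
  assumes [simp]: "x \<in> carrier G" shows "x \<otimes>\<^bsub>log_add\<^esub> x = x \<otimes> x"
proof -
  have "commutator G x x = \<one>" by (rule commutator_eqI) simp_all
  then show ?thesis by (simp add: twist_mult log_defect_def half_one)
qed

text \<open>Write \<open>c = [x, y]\<close>. Then \<open>x y = y x c\<close>, while
  \<open>log_defect x y = c^(-1/2)\<close> and \<open>log_defect y x = c^(1/2)\<close>, so both sums
  equal \<open>y x c^(1/2)\<close>.\<close>

lemma log_add_comm_group: "comm_group log_add"
proof (rule group.group_comm_groupI[OF log.twist_group])
  fix x y assume "x \<in> carrier log_add" "y \<in> carrier log_add"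
  then have [simp]: "x \<in> carrier G" "y \<in> carrier G" by simp_all
  have square: "commutator G x y = log_defect y x \<otimes> log_defect y x"
    by (simp add: log_defect_def)
  have inverse: "log_defect x y = inv (log_defect y x)"
    by (simp add: log_defect_inv)
  have "commutator G x y \<otimes> log_defect x y = log_defect y x"
    unfolding square inverse by (simp add: m_assoc)
  moreover have "x \<otimes> y \<otimes> log_defect x y = y \<otimes> x \<otimes> (commutator G x y \<otimes> log_defect x y)"
    by (simp add: commutator_mult[symmetric, of x y] D_comm[of "commutator G x y" "y \<otimes> x"] m_assoc)
  ultimately show "x \<otimes>\<^bsub>log_add\<^esub> y = y \<otimes>\<^bsub>log_add\<^esub> x"
    by (simp add: twist_mult)
qed

sublocale log_add: divisible_comm_group log_add
proof (intro divisible_comm_group.intro log_add_comm_group divisible_comm_group_axioms.intro)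
  show "uniquely_2_divisible log_add"
    using divisible unfolding uniquely_2_divisible_def twist_carrier
    by (subst bij_betw_cong[where g = "\<lambda>x. x \<otimes> x"]) (simp_all add: log_double)
qed

section \<open>The Lie algebra of a uniquely 2-divisible nil-2-group\<close>

definition log_lie :: "(rat, 'a) lie_alg" where
  "log_lie = \<lparr> carrier = carrier G, monoid.mult = undefined, one = undefined,
     zero = \<one>, add = mult log_add,
     smult = (\<lambda>r \<in> carrier Z_half. \<lambda>x \<in> carrier G. dyadic_pow log_add r x),
     bracket = (\<lambda>x \<in> carrier G. \<lambda>y \<in> carrier G. commutator G x y) \<rparr>"

lemma log_lie_simps [simp]:
  "carrier log_lie = carrier G" "\<zero>\<^bsub>log_lie\<^esub> = \<one>" "add log_lie = mult log_add"
  "\<lbrakk>r \<in> carrier Z_half; x \<in> carrier G\<rbrakk> \<Longrightarrow> r \<odot>\<^bsub>log_lie\<^esub> x = dyadic_pow log_add r x"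
  "\<lbrakk>x \<in> carrier G; y \<in> carrier G\<rbrakk> \<Longrightarrow> bracket log_lie x y = commutator G x y"
  by (simp_all add: log_lie_def)

lemma log_module: "module Z_half log_lie"
proof (rule moduleI)
  show "abelian_group log_lie"
  proof (rule abelian_groupI)
    fix x assume x: "x \<in> carrier log_lie"
    then show "\<exists>y \<in> carrier log_lie. y \<oplus>\<^bsub>log_lie\<^esub> x = \<zero>\<^bsub>log_lie\<^esub>"
      using log_add.l_inv_ex[of x] by simp
    fix y assume y: "y \<in> carrier log_lie"
    show "x \<oplus>\<^bsub>log_lie\<^esub> y = y \<oplus>\<^bsub>log_lie\<^esub> x" using log_add.m_comm[of x y] x y by simp
    show "x \<oplus>\<^bsub>log_lie\<^esub> y \<in> carrier log_lie" using log_add.m_closed[of x y] x y by simp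
    fix z assume z: "z \<in> carrier log_lie"
    show "(x \<oplus>\<^bsub>log_lie\<^esub> y) \<oplus>\<^bsub>log_lie\<^esub> z = x \<oplus>\<^bsub>log_lie\<^esub> (y \<oplus>\<^bsub>log_lie\<^esub> z)"
      using log_add.m_assoc[of x y z] x y z by simp
  next
    fix x assume x: "x \<in> carrier log_lie"
    then show "\<zero>\<^bsub>log_lie\<^esub> \<oplus>\<^bsub>log_lie\<^esub> x = x" using log_add.l_one[of x] by simp
  qed simp
next
  fix r s x assume "r \<in> carrier Z_half" "s \<in> carrier Z_half" "x \<in> carrier log_lie"
  then show "(r \<oplus>\<^bsub>Z_half\<^esub> s) \<odot>\<^bsub>log_lie\<^esub> x = r \<odot>\<^bsub>log_lie\<^esub> x \<oplus>\<^bsub>log_lie\<^esub> s \<odot>\<^bsub>log_lie\<^esub> x"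
    "(r \<otimes>\<^bsub>Z_half\<^esub> s) \<odot>\<^bsub>log_lie\<^esub> x = r \<odot>\<^bsub>log_lie\<^esub> (s \<odot>\<^bsub>log_lie\<^esub> x)"
    using log_add.dyadic_pow_add[of r s x] log_add.dyadic_pow_pow[of r s x]
      log_add.dyadic_pow_char(1)[of s x] by simp_all
next
  fix r x y assume "r \<in> carrier Z_half" "x \<in> carrier log_lie" "y \<in> carrier log_lie"
  then show "r \<odot>\<^bsub>log_lie\<^esub> (x \<oplus>\<^bsub>log_lie\<^esub> y) = r \<odot>\<^bsub>log_lie\<^esub> x \<oplus>\<^bsub>log_lie\<^esub> r \<odot>\<^bsub>log_lie\<^esub> y"
    using log_add.dyadic_pow_mult[of r x y] log.twist_closed[of x y] by simp
next
  fix r x assume "r \<in> carrier Z_half" "x \<in> carrier log_lie"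
  then show "r \<odot>\<^bsub>log_lie\<^esub> x \<in> carrier log_lie"
    using log_add.dyadic_pow_char(1)[of r x] by simp
next
  fix x assume "x \<in> carrier log_lie"
  then show "\<one>\<^bsub>Z_half\<^esub> \<odot>\<^bsub>log_lie\<^esub> x = x" using log_add.dyadic_pow_one[of x] by simp
qed (rule Z_half_cring)

text \<open>The commutator ignores the central factor \<open>log_defect x y\<close>, and for the
  central values of the commutator sum and product coincide.\<close>

lemma log_bracket_add:
  assumes [simp]: "x \<in> carrier G" "y \<in> carrier G" "z \<in> carrier G"
  shows "bracket log_lie (x \<oplus>\<^bsub>log_lie\<^esub> y) z = bracket log_lie x z \<oplus>\<^bsub>log_lie\<^esub> bracket log_lie y z"
    "bracket log_lie z (x \<oplus>\<^bsub>log_lie\<^esub> y) = bracket log_lie z x \<oplus>\<^bsub>log_lie\<^esub> bracket log_lie z y"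
  by (simp_all add: log.twist_closed log.twist_mult_D)
     (simp_all add: twist_mult commutator_left commutator_right)

lemma log_lie_algebra: "lie_algebra Z_half log_lie"
proof (intro lie_algebra.intro log_module lie_algebra_axioms.intro)
  fix x assume x: "x \<in> carrier log_lie"
  then show "bracket log_lie x x = \<zero>\<^bsub>log_lie\<^esub>" by (auto intro: commutator_eqI)
  fix y assume y: "y \<in> carrier log_lie"
  show "bracket log_lie x y \<in> carrier log_lie" using x y by simp
  {
    fix z assume z: "z \<in> carrier log_lie"
    show "bracket log_lie x (bracket log_lie y z) \<oplus>\<^bsub>log_lie\<^esub> bracket log_lie y (bracket log_lie z x)
        \<oplus>\<^bsub>log_lie\<^esub> bracket log_lie z (bracket log_lie x y) = \<zero>\<^bsub>log_lie\<^esub>"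
      \<comment> \<open>Each of the three terms is a commutator with a central element, hence
        trivial.\<close>
      using x y z by (simp add: log.twist_mult_D)
    show "bracket log_lie (x \<oplus>\<^bsub>log_lie\<^esub> y) z = bracket log_lie x z \<oplus>\<^bsub>log_lie\<^esub> bracket log_lie y z"
      "bracket log_lie x (y \<oplus>\<^bsub>log_lie\<^esub> z) = bracket log_lie x y \<oplus>\<^bsub>log_lie\<^esub> bracket log_lie x z"
      using x y z log_bracket_add by simp_all
  }
next
  fix r x y assume r: "r \<in> carrier Z_half" and x: "x \<in> carrier log_lie" and y: "y \<in> carrier log_lie"
  show "bracket log_lie (r \<odot>\<^bsub>log_lie\<^esub> x) y = r \<odot>\<^bsub>log_lie\<^esub> bracket log_lie x y"
    \<comment> \<open>Compatibility with scalars is automatic for an additive map.\<close>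
    by (rule additive_imp_Z_half_linear[OF log_module log_module _ _ r x, of "\<lambda>x. bracket log_lie x y"])
      (use y log_bracket_add in simp_all)
  show "bracket log_lie x (r \<odot>\<^bsub>log_lie\<^esub> y) = r \<odot>\<^bsub>log_lie\<^esub> bracket log_lie x y"
    by (rule additive_imp_Z_half_linear[OF log_module log_module _ _ r y, of "bracket log_lie x"])
      (use x log_bracket_add in simp_all)
qed

lemma log_nil2_lie: "nil2_lie log_lie"
proof -
  interpret L: lie_algebra Z_half log_lie by (rule log_lie_algebra)
  \<comment> \<open>Brackets are central in \<open>G\<close>, so they lie in the annihilator
    \<open>?K\<close>; as a submodule it then contains the whole derived submodule.\<close>
  let ?K = "{c \<in> carrier log_lie. \<forall>x \<in> carrier log_lie. bracket log_lie x c = \<zero>\<^bsub>log_lie\<^esub>}"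
  have "lie_derived Z_half log_lie \<subseteq> ?K"
  proof (rule L.lie_derived_minimal)
    show "submodule ?K Z_half log_lie"
    proof (rule L.submoduleI)
      fix c assume c: "c \<in> ?K"
      \<comment> \<open>Writing the negative as the multiple by \<open>-1\<close> lets linearity of
        the bracket handle it.\<close>
      have *: "\<ominus>\<^bsub>log_lie\<^esub> c = (- 1) \<odot>\<^bsub>log_lie\<^esub> c"
      proof (rule L.minus_equality)
        show "(- 1) \<odot>\<^bsub>log_lie\<^esub> c \<oplus>\<^bsub>log_lie\<^esub> c = \<zero>\<^bsub>log_lie\<^esub>"
          using c L.smult_l_distr[of "- 1" 1 c] L.smult_one[of c] L.smult_l_null[of c]
          by (simp del: log_lie_simps(2-))
      qed (use c L.smult_closed[of "- 1" c] in \<open>simp_all del: log_lie_simps\<close>)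
      show "\<ominus>\<^bsub>log_lie\<^esub> c \<in> ?K"
        using c by (simp add: * L.bracket_smult_right del: log_lie_simps)
    next
      fix c d assume "c \<in> ?K" "d \<in> ?K"
      then show "c \<oplus>\<^bsub>log_lie\<^esub> d \<in> ?K" by (simp add: L.bracket_add_right del: log_lie_simps)
    next
      fix r c assume "r \<in> carrier Z_half" "c \<in> ?K"
      then show "r \<odot>\<^bsub>log_lie\<^esub> c \<in> ?K" by (simp add: L.bracket_smult_right del: log_lie_simps)
    qed auto
  qed simp
  then show ?thesis unfolding nil2_lie_def using log_lie_algebra by auto
qed

lemma log_extensional_lie: "extensional_lie log_lie"
  unfolding extensional_lie_def log_lie_def twist_def by (auto simp: restrict_def intro!: ext)

end

text \<open>The scalar \<open>1/2\<close> of \<open>log_lie\<close> is the square root in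
  \<open>G\<close>, since \<open>log_add\<close> has the same squares. Hence the half bracket of
  \<open>log_lie\<close> is the inverse of \<open>log_defect\<close>, and \<open>exp\<close> undoes
  the twist defining \<open>log_add\<close>.\<close>

lemma exp_log:
  fixes G :: "'a monoid"
  assumes "divisible_nil2_group G" "extensional_monoid G"
  shows "exp_group (divisible_nil2_group.log_lie G) = G"
proof -
  interpret divisible_nil2_group G by fact
  let ?E = "exp_group log_lie"
  have mult: "x \<otimes>\<^bsub>?E\<^esub> y = x \<otimes>\<^bsub>G\<^esub> y" if [simp]: "x \<in> carrier G" "y \<in> carrier G" for x y
  proof -
    have "half_bracket log_lie x y = half (commutator G x y)"
      using log_add.dyadic_pow_half[of "commutator G x y" "half (commutator G x y)"]
      by (simp add: half_bracket_def log_double)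
    then have "x \<otimes>\<^bsub>?E\<^esub> y = (x \<otimes>\<^bsub>log_add\<^esub> y) \<otimes>\<^bsub>log_add\<^esub> inv\<^bsub>G\<^esub> (log_defect x y)"
      by (simp add: exp_mult log_defect_inv) (simp add: log_defect_def)
    also have "\<dots> = x \<otimes>\<^bsub>G\<^esub> y"
      using log.untwist_mult[of x y] by (simp add: twist_mult[of _ log_add] log.twist_closed)
    finally show ?thesis .
  qed
  have "mult ?E = (\<lambda>x \<in> carrier G. \<lambda>y \<in> carrier G. x \<otimes>\<^bsub>?E\<^esub> y)"
    using exp_extensional_monoid[of log_lie] by (simp add: extensional_monoid_def)
  also have "\<dots> = (\<lambda>x \<in> carrier G. \<lambda>y \<in> carrier G. x \<otimes>\<^bsub>G\<^esub> y)"
    by (intro restrict_ext mult)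
  also have "\<dots> = mult G"
    using assms(2) by (simp add: extensional_monoid_def)
  finally show ?thesis
    by (intro monoid.equality) (simp_all add: exp_group_def)
qed

section \<open>The isomorphism of categories\<close>

lemma structure_cat_simps [simp]:
  "Obj (structure_cat car P mor) = {X. P X}"
  "Arr (structure_cat car P mor) X Y = {f \<in> car X \<rightarrow>\<^sub>E car Y. mor X Y f}"
  "cat_id (structure_cat car P mor) X = (\<lambda>x \<in> car X. x)"
  "cat_comp (structure_cat car P mor) X Y Z g f = compose (car X) g f"
  by (simp_all add: structure_cat_def)

text \<open>The unit and associativity laws hold for all extensional functions, so only closure of
  \<open>mor\<close> under identities and composites depends on the structure.\<close>

lemma is_category_structure_cat:
  fixes car :: "'s \<Rightarrow> 'a set"
  assumes id: "\<And>X. P X \<Longrightarrow> mor X X (\<lambda>x \<in> car X. x)"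
    and comp: "\<And>X Y Z f g. \<lbrakk>P X; P Y; P Z; f \<in> car X \<rightarrow> car Y; g \<in> car Y \<rightarrow> car Z; mor X Y f; mor Y Z g\<rbrakk>
      \<Longrightarrow> mor X Z (compose (car X) g f)"
  shows "is_category (structure_cat car P mor)"
proof -
  have comp_id: "compose A f (\<lambda>x \<in> A. x) = f" "compose A (\<lambda>x \<in> B. x) f = f"
    if "f \<in> A \<rightarrow>\<^sub>E B" for A B and f :: "'a \<Rightarrow> 'a"
    using that by (auto simp: compose_def PiE_iff fun_eq_iff extensional_def)
  have assoc: "compose A (compose B h g) f = compose A h (compose A g f)"
    if "f \<in> A \<rightarrow>\<^sub>E B" for A B and f g h :: "'a \<Rightarrow> 'a"
    using that by (auto simp: compose_def PiE_iff fun_eq_iff)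
  have closed: "compose A g f \<in> A \<rightarrow>\<^sub>E C" if "f \<in> A \<rightarrow>\<^sub>E B" "g \<in> B \<rightarrow>\<^sub>E C"
    for A B C and f g :: "'a \<Rightarrow> 'a"
    using that by (auto simp: compose_def PiE_iff)
  show ?thesis
    unfolding is_category_def structure_cat_simps
  proof (intro conjI ballI, goal_cases)
    case (1 X)
    then show ?case using id by simp
  next
    case (2 X Y Z f g)
    then show ?case using comp[of X Y Z f g] closed[of f "car X" "car Y" g "car Z"] by (simp add: PiE_iff)
  next
    case (3 X Y f)
    then show ?case using comp_id(1)[of f "car X" "car Y"] by simp
  next
    case (4 X Y f)
    then show ?case using comp_id(2)[of f "car X" "car Y"] by simp
  next
    case (5 W X Y Z f g h)
    then show ?case using assoc[of f "car W" "car X" h g] by simp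
  qed
qed

lemma Niq_half_structure_cat:
  "Niq_half = structure_cat carrier
     (\<lambda>G. nil2_group G \<and> uniquely_2_divisible G \<and> extensional_monoid G) group_qmap"
  unfolding Niq_half_def Niq_def full_subcat_def structure_cat_def by auto

lemma qmap_rel_id:
  assumes "central_subgroup G D"
  shows "qmap_rel G D G D (\<lambda>x \<in> carrier G. x)"
proof -
  interpret central_subgroup G D by fact
  show ?thesis by (rule qmap_relI[where q = "\<lambda>_ _. \<one>\<^bsub>G\<^esub>"]) simp_all
qed

lemma qmap_rel_compose:
  assumes "central_subgroup G D" "central_subgroup H E" "central_subgroup K F"
    "qmap_rel G D H E f" "qmap_rel H E K F g"
  shows "qmap_rel G D K F (compose (carrier G) g f)"
proof -
  interpret G: central_subgroup G D by fact
  have "qmap_rel G D K F (\<lambda>x. g (f x))"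
    by (rule qmap_comp[of G D H E f K F g]) (intro qmap.intro qmap_axioms.intro assms)+
  then show ?thesis
  proof (rule qmap_relE)
    fix q assume q: "\<And>a. a \<in> carrier G \<Longrightarrow> g (f a) \<in> carrier K"
      "\<And>c. c \<in> D \<Longrightarrow> g (f c) \<in> F"
      "\<And>a c. a \<in> carrier G \<Longrightarrow> c \<in> D \<Longrightarrow> g (f (a \<otimes>\<^bsub>G\<^esub> c)) = g (f a) \<otimes>\<^bsub>K\<^esub> g (f c)"
      "\<And>a b. a \<in> carrier G \<Longrightarrow> b \<in> carrier G \<Longrightarrow> q a b \<in> F"
      "\<And>a b. a \<in> carrier G \<Longrightarrow> b \<in> carrier G \<Longrightarrow>
        g (f (a \<otimes>\<^bsub>G\<^esub> b)) = g (f a) \<otimes>\<^bsub>K\<^esub> g (f b) \<otimes>\<^bsub>K\<^esub> q a b"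
      "\<And>a a' b. a \<in> carrier G \<Longrightarrow> a' \<in> carrier G \<Longrightarrow> b \<in> carrier G \<Longrightarrow>
             q (a \<otimes>\<^bsub>G\<^esub> a') b = q a b \<otimes>\<^bsub>K\<^esub> q a' b"
      "\<And>a a' b. a \<in> carrier G \<Longrightarrow> a' \<in> carrier G \<Longrightarrow> b \<in> carrier G \<Longrightarrow>
             q b (a \<otimes>\<^bsub>G\<^esub> a') = q b a \<otimes>\<^bsub>K\<^esub> q b a'"
    show ?thesis
      by (rule qmap_relI[where q = q]) (simp_all add: compose_eq q)
  qed
qed

section \<open>The four categories and the two inclusions\<close>

lemma is_category_Niq_half: "is_category (Niq_half :: ('a monoid, 'a \<Rightarrow> 'a) cat)"
  unfolding Niq_half_structure_cat
proof (rule is_category_structure_cat)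
  fix X :: "'a monoid"
  assume X: "nil2_group X \<and> uniquely_2_divisible X \<and> extensional_monoid X"
  show "group_qmap X X (\<lambda>x \<in> carrier X. x)"
    using X by (simp add: group_qmap_iff qmap_rel_id nil2_central_subgroup)
  fix Y Z :: "'a monoid" and f g
  assume "nil2_group Y \<and> uniquely_2_divisible Y \<and> extensional_monoid Y"
    "nil2_group Z \<and> uniquely_2_divisible Z \<and> extensional_monoid Z"
    "group_qmap X Y f" "group_qmap Y Z g"
  then show "group_qmap X Z (compose (carrier X) g f)"
    using X by (auto simp: group_qmap_iff intro!: qmap_rel_compose[of X _ Y _ Z] nil2_central_subgroup)
qed

lemma is_category_Niq_Lie: "is_category (Niq_Lie :: ((rat, 'a) lie_alg, 'a \<Rightarrow> 'a) cat)"
  unfolding Niq_Lie_def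
proof (rule is_category_structure_cat)
  fix X :: "(rat, 'a) lie_alg"
  assume X: "nil2_lie X \<and> extensional_lie X"
  show "lie_qmap X X (\<lambda>x \<in> carrier X. x)"
    using X qmap_rel_id[OF lie_central_subgroup, of X] by (simp add: lie_qmap_iff)
  fix Y Z :: "(rat, 'a) lie_alg" and f g
  assume Y: "nil2_lie Y \<and> extensional_lie Y" and Z: "nil2_lie Z \<and> extensional_lie Z"
    and "lie_qmap X Y f" "lie_qmap Y Z g"
  then show "lie_qmap X Z (compose (carrier X) g f)"
    using X qmap_rel_compose[OF lie_central_subgroup lie_central_subgroup lie_central_subgroup, of X Y Z f g]
    by (simp add: lie_qmap_iff)
qed

lemma is_category_Nil_half: "is_category (Nil_half :: ('a monoid, 'a \<Rightarrow> 'a) cat)"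
  unfolding Nil_half_def
proof (rule is_category_structure_cat)
  fix X :: "'a monoid"
  assume X: "nil2_group X \<and> uniquely_2_divisible X \<and> extensional_monoid X"
  interpret X: group X using X by (simp add: nil2_group_def)
  show "(\<lambda>x \<in> carrier X. x) \<in> hom X X" by (rule homI) simp_all
  fix Y Z :: "'a monoid" and f g
  assume "f \<in> hom X Y" "g \<in> hom Y Z"
  then show "compose (carrier X) g f \<in> hom X Z"
    by (intro homI) (auto simp: compose_eq hom_def Pi_iff)
qed

lemma is_category_Nil_Lie: "is_category (Nil_Lie :: ((rat, 'a) lie_alg, 'a \<Rightarrow> 'a) cat)"
  unfolding Nil_Lie_def
proof (rule is_category_structure_cat)
  fix X :: "(rat, 'a) lie_alg"
  assume X: "nil2_lie X \<and> extensional_lie X"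
  interpret X: lie_algebra Z_half X using X by (simp add: nil2_lie_def)
  show "lie_hom X X (\<lambda>x \<in> carrier X. x)"
    by (auto simp: lie_hom_def X.bracket_closed)
  fix Y Z :: "(rat, 'a) lie_alg" and f g
  assume "lie_hom X Y f" "lie_hom Y Z g"
  then show "lie_hom X Z (compose (carrier X) g f)"
    by (auto simp: lie_hom_def compose_eq X.bracket_closed Pi_iff)
qed

lemma hom_group_qmap:
  assumes "nil2_group G" "nil2_group H" "f \<in> hom G H"
  shows "group_qmap G H f"
proof -
  have G: "group G" and H: "group H" using assms by (simp_all add: nil2_group_def)
  interpret f: group_hom G H f
    using assms(3) by (intro group_hom.intro G H group_hom_axioms.intro)
  have sub: "subgroup (derived H (carrier H)) H" by (rule group.derived_is_subgroup[OF H]) simp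
  have "cross_effect G H f a b = \<one>\<^bsub>H\<^esub>" if "a \<in> carrier G" "b \<in> carrier G" for a b
    using that by (simp add: cross_effect_def)
  then show ?thesis
    unfolding group_qmap_def weakly_quadratic_def
    using assms(1,2) subgroup.one_closed[OF sub] by auto
qed

text \<open>The claim is transported along \<open>exp\<close>, where it says that a group
  homomorphism, having trivial cross effect, is a q-map.\<close>

lemma lie_hom_lie_qmap:
  assumes "nil2_lie L" "nil2_lie L'" "lie_hom L L' f"
  shows "lie_qmap L L' f"
  unfolding exp_qmap_iff[OF assms(1,2), symmetric]
  by (rule hom_group_qmap) (intro exp_nil2_group exp_lie_hom assms)+

lemma is_subcategory_structure_cat:
  assumes "is_category (structure_cat car P mor')" "is_category (structure_cat car P mor)"
    and "\<And>X Y f. \<lbrakk>P X; P Y; mor' X Y f\<rbrakk> \<Longrightarrow> mor X Y f"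
  shows "is_subcategory (structure_cat car P mor') (structure_cat car P mor)"
  unfolding is_subcategory_def using assms by auto

section \<open>Functors that leave the underlying maps unchanged\<close>

lemma is_functor_structure_cat:
  assumes "is_category (structure_cat car P mor)" "is_category (structure_cat car' P' mor')"
    and "\<And>X. P X \<Longrightarrow> P' (F X)" "\<And>X. P X \<Longrightarrow> car' (F X) = car X"
    and "\<And>X Y f. \<lbrakk>P X; P Y; mor X Y f\<rbrakk> \<Longrightarrow> mor' (F X) (F Y) f"
  shows "is_functor (structure_cat car P mor) (structure_cat car' P' mor')
    \<lparr>on_obj = F, on_arr = (\<lambda>_ _ f. f)\<rparr>"
  unfolding is_functor_def using assms by auto

text \<open>Arrows are left unchanged as maps, so only the bijection on objects has to be inverted.\<close>

lemma is_cat_isomorphism_structure_cat: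
  assumes cat: "is_category (structure_cat car P mor)" "is_category (structure_cat car' P' mor')"
    and bij: "bij_betw F {X. P X} {Y. P' Y}" and car: "\<And>X. P X \<Longrightarrow> car' (F X) = car X"
    and mor: "\<And>X Y f. \<lbrakk>P X; P Y\<rbrakk> \<Longrightarrow> mor' (F X) (F Y) f \<longleftrightarrow> mor X Y f"
  shows "is_cat_isomorphism (structure_cat car P mor) (structure_cat car' P' mor')
    \<lparr>on_obj = F, on_arr = (\<lambda>_ _ f. f)\<rparr>"
proof -
  let ?F' = "inv_into {X. P X} F"
  have F: "P' (F X)" "?F' (F X) = X" if "P X" for X
    using that bij bij_betw_inv_into_left[OF bij] by (auto simp: bij_betw_def)
  have F': "P (?F' Y)" "F (?F' Y) = Y" if "P' Y" for Y
    using that bij_betw_inv_into[OF bij] bij_betw_inv_into_right[OF bij] by (auto simp: bij_betw_def)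
  have "is_functor (structure_cat car P mor) (structure_cat car' P' mor')
      \<lparr>on_obj = F, on_arr = (\<lambda>_ _ f. f)\<rparr>"
    using mor car F by (intro is_functor_structure_cat cat) auto
  moreover have "is_functor (structure_cat car' P' mor') (structure_cat car P mor)
      \<lparr>on_obj = ?F', on_arr = (\<lambda>_ _ f. f)\<rparr>"
  proof (rule is_functor_structure_cat[OF cat(2,1)])
    show "car (?F' Y) = car' Y" if "P' Y" for Y
      using car[OF F'(1)[OF that]] F'(2)[OF that] by simp
    show "mor (?F' X) (?F' Y) f" if "P' X" "P' Y" "mor' X Y f" for X Y f
      using mor[OF F'(1)[OF that(1)] F'(1)[OF that(2)], of f] F'(2) that by simp
  qed (rule F')
  ultimately show ?thesis
    unfolding is_cat_isomorphism_def
    by (intro conjI exI[of _ "\<lparr>on_obj = ?F', on_arr = (\<lambda>_ _ f. f)\<rparr>"])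
      (simp_all add: left_inverse_functor_def F F')
qed

lemma exp_group_bij:
  "bij_betw exp_group {L :: (rat, 'a) lie_alg. nil2_lie L \<and> extensional_lie L}
     {G. nil2_group G \<and> uniquely_2_divisible G \<and> extensional_monoid G}"
  unfolding bij_betw_def
proof (intro conjI equalityI subsetI)
  show "inj_on exp_group {L :: (rat, 'a) lie_alg. nil2_lie L \<and> extensional_lie L}"
    by (rule inj_onI) (auto intro: exp_group_inj)
  fix G :: "'a monoid"
  assume "G \<in> {G. nil2_group G \<and> uniquely_2_divisible G \<and> extensional_monoid G}"
  then have G: "divisible_nil2_group G" "extensional_monoid G"
    by (simp_all add: divisible_nil2_group_def)
  show "G \<in> exp_group ` {L. nil2_lie L \<and> extensional_lie L}"
    using exp_log[OF G] divisible_nil2_group.log_nil2_lie[OF G(1)]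
      divisible_nil2_group.log_extensional_lie[OF G(1)]
    by (intro image_eqI[of _ _ "divisible_nil2_group.log_lie G"]) simp_all
qed (auto intro: exp_nil2_group exp_uniquely_2_divisible exp_extensional_monoid)

theorem theorem8p3:
  shows "\<exists>F :: ((rat, 'a) lie_alg, 'a \<Rightarrow> 'a, 'a monoid, 'a \<Rightarrow> 'a) cat_map.
           is_cat_isomorphism Niq_Lie Niq_half F \<and>
           extends_functor Niq_Lie Niq_half F Nil_Lie Nil_half exp_functor"
proof (intro exI conjI)
  \<comment> \<open>The extension is given by the same data \<open>exp_functor\<close>: by
    \<open>exp_qmap_iff\<close> it also identifies the larger sets of arrows, each map going to
    itself.\<close>
  show iso: "is_cat_isomorphism Niq_Lie Niq_half
      (exp_functor :: ((rat, 'a) lie_alg, 'a \<Rightarrow> 'a, 'a monoid, 'a \<Rightarrow> 'a) cat_map)"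
    using is_category_Niq_Lie is_category_Niq_half exp_group_bij
    unfolding Niq_half_structure_cat Niq_Lie_def exp_functor_def
    by (rule is_cat_isomorphism_structure_cat) (simp_all add: exp_qmap_iff)
  have "is_subcategory Nil_Lie (Niq_Lie :: ((rat, 'a) lie_alg, 'a \<Rightarrow> 'a) cat)"
    using is_category_Nil_Lie is_category_Niq_Lie unfolding Nil_Lie_def Niq_Lie_def
    by (rule is_subcategory_structure_cat) (auto intro: lie_hom_lie_qmap)
  moreover have "is_subcategory Nil_half (Niq_half :: ('a monoid, 'a \<Rightarrow> 'a) cat)"
    using is_category_Nil_half is_category_Niq_half unfolding Nil_half_def Niq_half_structure_cat
    by (rule is_subcategory_structure_cat) (auto intro: hom_group_qmap)
  moreover have "is_functor Nil_Lie Nil_half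
      (exp_functor :: ((rat, 'a) lie_alg, 'a \<Rightarrow> 'a, 'a monoid, 'a \<Rightarrow> 'a) cat_map)"
    using is_category_Nil_Lie is_category_Nil_half unfolding Nil_Lie_def Nil_half_def exp_functor_def
    by (rule is_functor_structure_cat)
      (auto intro: exp_nil2_group exp_uniquely_2_divisible exp_extensional_monoid exp_lie_hom)
  ultimately show "extends_functor Niq_Lie Niq_half exp_functor Nil_Lie Nil_half
      (exp_functor :: ((rat, 'a) lie_alg, 'a \<Rightarrow> 'a, 'a monoid, 'a \<Rightarrow> 'a) cat_map)"
    using iso by (simp add: extends_functor_def is_cat_isomorphism_def)
qed

end
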